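(* Let $G$ be a tournament and $r$ a vertex of $G$. Then the flip graph $\mathcal{F}_r(G)$ of the arborescences of $G$ rooted in $r$ is empty or admits a Hamiltonian path.
   Context: Graphs are finite and loopless. A tournament is a directed graph with exactly one arc between every two distinct vertices. An arborescence of a directed graph $G$ rooted in $r$ is a spanning tree of $G$ all of whose arcs are oriented away from $r$. Two arborescences differ by an arc flip if they are equal on all arcs but one (one is obtained from the other by removing one arc and adding another). The flip graph $\mathcal{F}_r(G)$ is the undirected graph whose vertices are the arborescences of $G$ rooted in $r$, two of them being adjacent if they differ by an arc flip. It is called empty if it has no vertex. A Hamiltonian path is a path visiting every vertex exactly once (a single-vertex graph has one). *)

theory Defs
  imports "Graph_Theory.Graph_Theory"
begin

locale tournament = fin_digraph + loopfree_digraph +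
  assumes ex1_arc: "\<lbrakk>u \<in> verts G; v \<in> verts G; u \<noteq> v\<rbrakk> \<Longrightarrow>
    \<exists>!e. e \<in> arcs G \<and> {tail G e, head G e} = {u, v}"

text \<open>
  The predicates \<open>forest\<close> and \<open>tree\<close> of \<open>Digraph_Component\<close> only exclude directed cycles. Here
  cycles of the underlying undirected graph are meant. In \<open>mk_symmetric H\<close>, going back and forth
  along one edge is a closed walk of length two, so only its cycles of length at least three are
  cycles of the undirected graph. The first two conjuncts exclude undirected cycles of length one
  (loops) and two (parallel or antiparallel arcs), which \<open>mk_symmetric H\<close> does not show.
\<close>

definition underlying_forest :: "('a, 'b) pre_digraph \<Rightarrow> bool" where
  "underlying_forest H \<longleftrightarrow>
     (\<forall>e\<in>arcs H. tail H e \<noteq> head H e) \<and>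
     inj_on (\<lambda>e. {tail H e, head H e}) (arcs H) \<and>
     \<not> (\<exists>p. pre_digraph.cycle (with_proj (mk_symmetric H)) p \<and> length p \<ge> 3)"

definition underlying_tree :: "('a, 'b) pre_digraph \<Rightarrow> bool" where
  "underlying_tree H \<longleftrightarrow> connected H \<and> underlying_forest H"

text \<open>
  An arc is oriented away from \<open>r\<close> if no path of the underlying undirected graph that starts in
  \<open>r\<close> traverses it from its head to its tail.
\<close>

definition oriented_away :: "('a, 'b) pre_digraph \<Rightarrow> 'a \<Rightarrow> 'b \<Rightarrow> bool" where
  "oriented_away H r e \<longleftrightarrow>
     (\<forall>p v. pre_digraph.apath (with_proj (mk_symmetric H)) r p v \<longrightarrow> (head H e, tail H e) \<notin> set p)"

definition arborescence :: "('a, 'b) pre_digraph \<Rightarrow> 'a \<Rightarrow> ('a, 'b) pre_digraph \<Rightarrow> bool" where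
  "arborescence G r T \<longleftrightarrow>
     spanning T G \<and> underlying_tree T \<and> r \<in> verts T \<and> (\<forall>e\<in>arcs T. oriented_away T r e)"

definition arc_flip :: "('a, 'b) pre_digraph \<Rightarrow> ('a, 'b) pre_digraph \<Rightarrow> bool" where
  "arc_flip S T \<longleftrightarrow> (\<exists>e f. e \<in> arcs S \<and> f \<notin> arcs S \<and> arcs T = insert f (arcs S - {e}))"

text \<open>
  Undirected graphs are represented, as usual in this library, by symmetric digraphs.
\<close>

definition flip_graph :: "('a, 'b) pre_digraph \<Rightarrow> 'a \<Rightarrow> ('a, 'b) pre_digraph pair_pre_digraph" where
  "flip_graph G r = \<lparr> pverts = {T. arborescence G r T},
     parcs = {(S, T). arborescence G r S \<and> arborescence G r T \<and> arc_flip S T} \<rparr>"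

definition hamiltonian_path :: "('a, 'b) pre_digraph \<Rightarrow> 'a vwalk \<Rightarrow> bool" where
  "hamiltonian_path F p \<longleftrightarrow> vpath p F \<and> set p = verts F"

lemma arc_flip_sym: "arc_flip S T \<Longrightarrow> arc_flip T S"
  unfolding arc_flip_def
proof (elim exE conjE)
  fix e f
  assume "e \<in> arcs S" "f \<notin> arcs S" "arcs T = insert f (arcs S - {e})"
  then have "f \<in> arcs T \<and> e \<notin> arcs T \<and> arcs S = insert e (arcs T - {f})"
    by auto
  then show "\<exists>e f. e \<in> arcs T \<and> f \<notin> arcs T \<and> arcs S = insert f (arcs T - {e})"
    by blast
qed

lemma arc_flip_irrefl: "\<not> arc_flip T T"
  by (auto simp: arc_flip_def)

lemma (in fin_digraph) finite_arborescences: "finite {T. arborescence G r T}"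
proof (rule finite_subset)
  show "{T. arborescence G r T} \<subseteq>
      (\<lambda>A. \<lparr> verts = verts G, arcs = A, tail = tail G, head = head G \<rparr>) ` Pow (arcs G)"
  proof
    fix T
    assume "T \<in> {T. arborescence G r T}"
    then have "verts T = verts G" "arcs T \<subseteq> arcs G" "tail T = tail G" "head T = head G"
      by (auto simp: arborescence_def spanning_def subgraph_def compatible_def)
    then show "T \<in> (\<lambda>A. \<lparr> verts = verts G, arcs = A, tail = tail G, head = head G \<rparr>) ` Pow (arcs G)"
      by (intro image_eqI[where x = "arcs T"]) auto
  qed
qed simp

lemma (in fin_digraph) pair_graph_flip_graph: "pair_graph (flip_graph G r)"
proof
  show "finite (pverts (flip_graph G r))"
    using finite_arborescences by (simp add: flip_graph_def)
  have "parcs (flip_graph G r) \<subseteq> {T. arborescence G r T} \<times> {T. arborescence G r T}"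
    by (auto simp: flip_graph_def)
  then show "finite (parcs (flip_graph G r))"
    using finite_arborescences by (meson finite_SigmaI finite_subset)
qed (auto simp: flip_graph_def symmetric_def arc_flip_irrefl intro!: symI arc_flip_sym)

end

theory Submission
  imports Defs
begin

text \<open>
  An arborescence rooted in \<open>r\<close> is an acyclic choice of a parent \<open>p v\<close> among the in-neighbours of
  each \<open>v \<noteq> r\<close>, and an arc flip changes one parent. Contracting an arc from the root to \<open>v\<close>
  merges \<open>v\<close> into the root, which creates multiple root arcs; \<open>U\<close> denotes the set of vertices not
  yet merged. By induction on the number of arcs into \<open>U\<close>, for every semicomplete digraph the flip
  graph is empty or has a Hamiltonian path, and this path can start anywhere if some \<open>v\<close> has two
  root arcs.

  Forgetting the parent of a root child \<open>v\<close> maps the flip graph to the one with \<open>v\<close> contracted.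
  The fibres are cliques that all contain the root arcs of \<open>v\<close>. With two root arcs one zigzags
  through the fibres along a Hamiltonian path of the base; with three common elements one can also
  make an excursion and return, and so start in any fibre. If no vertex has two root arcs, take root
  children \<open>a\<close> and \<open>b\<close> with an arc from \<open>a\<close> to \<open>b\<close>. First visit the arborescences in which a given
  root arc to \<open>a\<close> is absent, then those in which it is present: contracting \<open>a\<close> gives \<open>b\<close> two root
  arcs, so the second path can start wherever the first one ends.
\<close>

section \<open>Hamiltonian paths and clique fibrations\<close>

inductive ham_path :: "('v \<Rightarrow> 'v \<Rightarrow> bool) \<Rightarrow> 'v set \<Rightarrow> 'v \<Rightarrow> 'v \<Rightarrow> bool" for R where
  single: "ham_path R {x} x x"
| step: "ham_path R V y z \<Longrightarrow> R x y \<Longrightarrow> x \<notin> V \<Longrightarrow> ham_path R (insert x V) x z"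

lemma ham_path_mem: "ham_path R V x y \<Longrightarrow> x \<in> V \<and> y \<in> V"
  by (induction rule: ham_path.induct) auto

lemma ham_path_join:
  assumes "ham_path R V x y" "ham_path R W x' y'" "R y x'" "V \<inter> W = {}"
  shows "ham_path R (V \<union> W) x y'"
  using assms
proof (induction rule: ham_path.induct)
  case (single x)
  then show ?case using ham_path.step[of R W x' y' x] by auto
next
  case (step V y z x)
  then show ?case using ham_path.step[of R "V \<union> W" y y' x] by auto
qed

lemma ham_path_rev: "ham_path R V x y \<Longrightarrow> symp R \<Longrightarrow> ham_path R V y x"
proof (induction rule: ham_path.induct)
  case (single x)
  show ?case by (rule ham_path.single)
next
  case (step V y z x)
  then have "ham_path R (V \<union> {x}) z x"
    by (intro ham_path_join[OF _ ham_path.single]) (auto dest: sympD)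
  then show ?case by simp
qed

lemma ham_path_clique:
  assumes "finite V" "x \<in> V" "y \<in> V" "x \<noteq> y"
    and "\<And>a b. a \<in> V \<Longrightarrow> b \<in> V \<Longrightarrow> a \<noteq> b \<Longrightarrow> R a b"
  shows "ham_path R V x y"
proof -
  have "ham_path R (insert x W) x y"
    if "finite W" "W \<subseteq> V" "y \<in> W" "x \<in> V" "x \<notin> W" for W x
    using that
  proof (induction "card W" arbitrary: W x)
    case 0
    then show ?case by auto
  next
    case (Suc n)
    show ?case
    proof (cases "W = {y}")
      case True
      then show ?thesis using Suc.prems assms(5) by (auto intro: ham_path.step ham_path.single)
    next
      case False
      then obtain x' where x': "x' \<in> W" "x' \<noteq> y" using Suc.prems by auto
      have "ham_path R (insert x' (W - {x'})) x' y"
        using Suc.prems Suc.hyps(2) x' by (intro Suc.hyps(1)) auto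
      then have "ham_path R W x' y" using x' by (simp add: insert_absorb)
      then show ?thesis using Suc.prems x' assms(5) by (intro ham_path.step[of R W x' y x]) auto
    qed
  qed
  from this[of "V - {x}" x] show ?thesis using assms by (auto simp: insert_absorb)
qed

text \<open>Cutting at \<open>t\<close> and reversing the first piece makes \<open>t\<close> the
  start of \<open>A\<close>. Over a base path, an excursion over \<open>A\<close> that returns to
  \<open>t\<close> can then continue over \<open>B\<close>, which is empty if \<open>t\<close> comes
  last.\<close>

lemma ham_path_split:
  assumes "ham_path R V x y" "t \<in> V" "symp R"
  obtains A B where "ham_path R A t x" "V = A \<union> B" "A \<inter> B = {}"
    "B = {} \<or> (\<exists>t'. R t t' \<and> ham_path R B t' y)"
proof -
  have "\<exists>A B. ham_path R A t x \<and> V = A \<union> B \<and> A \<inter> B = {} \<and> (B = {} \<or> (\<exists>t'. R t t' \<and> ham_path R B t' y))"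
    using assms
  proof (induction rule: ham_path.induct)
    case (single x)
    then show ?case using ham_path.single[of R x] by blast
  next
    case (step V y z x)
    show ?case
    proof (cases "t = x")
      case True
      then show ?thesis using step.hyps ham_path.single[of R x]
        by (intro exI[of _ "{x}"] exI[of _ V]) auto
    next
      case False
      then obtain A B where AB: "ham_path R A t y" "V = A \<union> B" "A \<inter> B = {}"
        "B = {} \<or> (\<exists>t'. R t t' \<and> ham_path R B t' z)"
        using step by blast
      have "ham_path R (A \<union> {x}) t x"
        using AB step by (intro ham_path_join[OF AB(1) ham_path.single]) (auto dest: sympD)
      then show ?thesis using AB step.hyps(3)
        by (intro exI[of _ "insert x A"] exI[of _ B]) auto
    qed
  qed
  then show thesis using that by blast
qed

text \<open>\<open>t'\<close> may come before or after \<open>t\<close>, so \<open>t\<close> is kept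
  with the side that avoids \<open>t'\<close>, and the other side is traversed away from
  \<open>t\<close>.\<close>

lemma ham_path_split2:
  assumes "ham_path R V x y" "t \<in> V" "t' \<in> V" "t \<noteq> t'" "symp R"
  obtains A B z t1 z' where "ham_path R A t z" "R t t1" "ham_path R B t1 z'" "t' \<in> B" "V = A \<union> B" "A \<inter> B = {}"
proof -
  obtain A B where AB: "ham_path R A t x" "V = A \<union> B" "A \<inter> B = {}"
    "B = {} \<or> (\<exists>t'. R t t' \<and> ham_path R B t' y)"
    using ham_path_split[OF assms(1,2,5)] .
  show thesis
  proof (cases "t' \<in> B")
    case True
    then show thesis using AB that by blast
  next
    case False
    then have t': "t' \<in> A" using AB assms by auto
    from AB(1) show thesis
    proof cases
      case single
      then show thesis using t' assms by auto
    next
      case (step A' t1)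
      have "ham_path R (insert t B) t (if B = {} then t else y)"
        using AB ham_path.single[of R t] ham_path.step[of R B _ y t] step(1) by auto
      then show thesis
        using that[of "insert t B" _ t1 A' x] step AB t' assms(4) by auto
    qed
  qed
qed

lemma ham_path_image:
  assumes "ham_path R V x y" "inj_on f V" "\<And>a b. a \<in> V \<Longrightarrow> b \<in> V \<Longrightarrow> R a b \<Longrightarrow> Q (f a) (f b)"
  shows "ham_path Q (f ` V) (f x) (f y)"
  using assms
proof (induction rule: ham_path.induct)
  case (single x)
  then show ?case using ham_path.single[of Q "f x"] by simp
next
  case (step V y z x)
  have "ham_path Q (insert (f x) (f ` V)) (f x) (f z)"
  proof (rule ham_path.step)
    show "ham_path Q (f ` V) (f y) (f z)" using step by auto
    show "Q (f x) (f y)" using step ham_path_mem[OF step.hyps(1)] by auto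
    show "f x \<notin> f ` V" using step by (auto simp: inj_on_def)
  qed
  then show ?case by simp
qed

text \<open>This is the Cartesian product of \<open>R\<close> with a complete graph. On
  \<open>Sigma V F\<close> it models cliques \<open>F t\<close> over a base graph, joined along each
  base edge at the elements common to both fibres.\<close>

definition fibre_adj :: "('v \<Rightarrow> 'v \<Rightarrow> bool) \<Rightarrow> 'v \<times> 'w \<Rightarrow> 'v \<times> 'w \<Rightarrow> bool" where
  "fibre_adj R s t \<longleftrightarrow> (fst s = fst t \<and> snd s \<noteq> snd t) \<or> (R (fst s) (fst t) \<and> snd s = snd t)"

lemma symp_fibre_adj: "symp R \<Longrightarrow> symp (fibre_adj R)"
  by (auto simp: symp_def fibre_adj_def)

lemma ham_path_fibre:
  assumes "finite (F t)" "x \<in> F t" "y \<in> F t" "x \<noteq> y"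
  shows "ham_path (fibre_adj R) (Sigma {t} F) (t, x) (t, y)"
  using assms by (intro ham_path_clique) (auto simp: fibre_adj_def)

lemma ham_path_fibre_join:
  assumes "ham_path (fibre_adj R) (Sigma A F) s (t, e)" "ham_path (fibre_adj R) (Sigma B F) (t', e) w"
    "R t t'" "A \<inter> B = {}"
  shows "ham_path (fibre_adj R) (Sigma (A \<union> B) F) s w"
proof -
  have "ham_path (fibre_adj R) (Sigma A F \<union> Sigma B F) s w"
    using assms by (intro ham_path_join[OF assms(1,2)]) (auto simp: fibre_adj_def)
  then show ?thesis by (simp add: Sigma_Un_distrib1)
qed

text \<open>Each fibre is crossed from its entry to whichever of \<open>e\<close>, \<open>e'\<close>
  differs from the entry; this exit also belongs to the next fibre and is the entry there.\<close>

lemma zigzag2: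
  assumes "ham_path R B t y" "x \<in> F t" "\<And>t. t \<in> B \<Longrightarrow> finite (F t) \<and> {e, e'} \<subseteq> F t" "e \<noteq> e'"
  shows "\<exists>w. ham_path (fibre_adj R) (Sigma B F) (t, x) w"
  using assms
proof (induction arbitrary: x rule: ham_path.induct)
  case (single t)
  obtain d where "d \<in> {e, e'}" "d \<noteq> x" using single by auto
  then show ?case using ham_path_fibre[of F t x d R] single by blast
next
  case (step V y z t)
  obtain d where d: "d \<in> {e, e'}" "d \<noteq> x" using step by auto
  have "d \<in> F t" "d \<in> F y" using step.prems(2) ham_path_mem[OF step.hyps(1)] d by auto
  moreover obtain w where "ham_path (fibre_adj R) (Sigma V F) (y, d) w"
    using step.IH[of d] step.prems calculation by blast
  moreover have "ham_path (fibre_adj R) (Sigma {t} F) (t, x) (t, d)"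
    using step.prems d calculation by (intro ham_path_fibre) auto
  ultimately show ?case
    using ham_path_fibre_join[of R "{t}" F "(t, x)" t d V y w] step.hyps by (metis Int_insert_left_if0 insert_is_Un inf_bot_left)
qed

text \<open>The fibres over the path form a ladder: go out along \<open>e\<close>, cross at the far
  end and come back along \<open>e'\<close>.\<close>

lemma excursion2:
  assumes "ham_path R A t y" "symp R" "e \<noteq> e'" "\<And>t. t \<in> A \<Longrightarrow> F t = {e, e'}"
  shows "ham_path (fibre_adj R) (Sigma A F) (t, e) (t, e')"
  using assms
proof (induction rule: ham_path.induct)
  case (single t)
  then show ?case by (intro ham_path_fibre) auto
next
  case (step V y z t)
  have "ham_path (fibre_adj R) (Sigma V F) (y, e) (y, e')" using step by auto
  then have "ham_path (fibre_adj R) (insert (t, e) (Sigma V F)) (t, e) (y, e')"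
    using step.hyps by (intro ham_path.step) (auto simp: fibre_adj_def)
  then have "ham_path (fibre_adj R) (insert (t, e) (Sigma V F) \<union> {(t, e')}) (t, e) (t, e')"
    using step.hyps step.prems by (intro ham_path_join[OF _ ham_path.single]) (auto simp: fibre_adj_def dest: sympD)
  moreover have "insert (t, e) (Sigma V F) \<union> {(t, e')} = Sigma (insert t V) F" using step by auto
  ultimately show ?case by simp
qed

lemma ham_path_fibre_start2:
  assumes "ham_path R V y z" "symp R" "t \<in> V" "{x, x'} = {e, e'}" "e \<noteq> e'" "\<And>t. t \<in> V \<Longrightarrow> F t = {e, e'}"
  shows "\<exists>w. ham_path (fibre_adj R) (Sigma V F) (t, x) w"
proof -
  obtain A B where AB: "ham_path R A t y" "V = A \<union> B" "A \<inter> B = {}"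
    "B = {} \<or> (\<exists>t'. R t t' \<and> ham_path R B t' z)"
    using ham_path_split[OF assms(1,3,2)] .
  have "x \<noteq> x'" "{e, e'} = {x, x'}" using assms by auto
  then have A: "ham_path (fibre_adj R) (Sigma A F) (t, x) (t, x')"
    using assms AB by (intro excursion2[OF AB(1)]) auto
  show ?thesis
  proof (cases "B = {}")
    case True
    then show ?thesis using A AB by auto
  next
    case False
    then obtain t' where t': "R t t'" "ham_path R B t' z" using AB by auto
    have F: "F u = {x, x'}" if "u \<in> B" for u using that assms(4,6) AB(2) by blast
    then have "x' \<in> F t'" using ham_path_mem[OF t'(2)] by blast
    then obtain w where "ham_path (fibre_adj R) (Sigma B F) (t', x') w"
      using zigzag2[OF t'(2), of x' F x x'] F \<open>x \<noteq> x'\<close> by auto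
    then show ?thesis using ham_path_fibre_join[OF A _ t'(1) AB(3)] AB by blast
  qed
qed

text \<open>The fibre over \<open>t\<close> is visited in two portions: \<open>x\<close> and the
  exit \<open>a\<close> before the rest of the base, then everything else from the return point
  \<open>b\<close> to \<open>e\<close>. Three common elements leave room for distinct
  \<open>a\<close>, \<open>b\<close> and \<open>e\<close>.\<close>

lemma excursion3:
  assumes "ham_path R A t y" "symp R" "\<And>t. t \<in> A \<Longrightarrow> finite (F t) \<and> C \<subseteq> F t" "card C = 3"
    "x \<in> F t" "e \<in> C" "x \<noteq> e"
  shows "ham_path (fibre_adj R) (Sigma A F) (t, x) (t, e)"
  using assms
proof (induction arbitrary: x e rule: ham_path.induct)
  case (single t)
  then show ?case by (intro ham_path_fibre) auto
next
  case (step V y z t)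
  have finC: "finite C" using step.prems by (simp add: card_ge_0_finite)
  obtain a b where ab: "a \<in> C" "b \<in> C" "a \<noteq> b" "a \<noteq> e" "b \<noteq> e" "x \<noteq> b" "x \<in> C \<longrightarrow> x = a"
  proof -
    have "card (C - {e}) = 2" using step.prems finC by simp
    then obtain c d where cd: "C - {e} = {c, d}" "c \<noteq> d" by (auto simp: card_2_iff)
    show thesis
    proof (cases "x = d")
      case True
      then show thesis using that[of d c] cd step.prems by blast
    next
      case False
      then show thesis using that[of c d] cd step.prems by blast
    qed
  qed
  have F: "finite (F t)" "a \<in> F t" "b \<in> F t" "e \<in> F t" "a \<in> F y" "b \<in> F y"
    using step.prems(2) ham_path_mem[OF step.hyps(1)] ab step.prems by blast+
  have 1: "ham_path (fibre_adj R) (Pair t ` insert x {a}) (t, x) (t, a)"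
  proof (cases "x = a")
    case True
    then show ?thesis using ham_path.single[of "fibre_adj R" "(t, a)"] by auto
  next
    case False
    then show ?thesis by (intro ham_path_clique) (auto simp: fibre_adj_def)
  qed
  have 2: "ham_path (fibre_adj R) (Sigma V F) (y, a) (y, b)"
    using step.IH[of a b] step.prems F ab by auto
  have 3: "ham_path (fibre_adj R) (Pair t ` (F t - {x, a})) (t, b) (t, e)"
    using F ab step.prems by (intro ham_path_clique) (auto simp: fibre_adj_def)
  have sy: "R y t" using step by (auto dest: sympD)
  have "ham_path (fibre_adj R) (Pair t ` insert x {a} \<union> Sigma V F) (t, x) (y, b)"
    using step.hyps by (intro ham_path_join[OF 1 2]) (auto simp: fibre_adj_def)
  then have "ham_path (fibre_adj R) ((Pair t ` insert x {a} \<union> Sigma V F) \<union> Pair t ` (F t - {x, a})) (t, x) (t, e)"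
    using step.hyps sy by (intro ham_path_join[OF _ 3]) (auto simp: fibre_adj_def)
  moreover have "(Pair t ` insert x {a} \<union> Sigma V F) \<union> Pair t ` (F t - {x, a}) = Sigma (insert t V) F"
    using F step.prems by auto
  ultimately show ?case by simp
qed

text \<open>The fibres before \<open>t'\<close> are crossed one by one; the base from
  \<open>t'\<close> onwards is covered by an excursion that returns to the fibre over
  \<open>t'\<close>.\<close>

lemma zigzag3:
  assumes "ham_path R B t y" "symp R" "\<And>t. t \<in> B \<Longrightarrow> finite (F t) \<and> C \<subseteq> F t" "card C = 3"
    "t' \<in> B" "z \<in> F t'" "e \<in> C" "e \<noteq> z"
  shows "ham_path (fibre_adj R) (Sigma B F) (t, e) (t', z)"
  using assms
proof (induction arbitrary: e rule: ham_path.induct)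
  case (single t)
  then have "t' = t" "z \<in> F t" "e \<in> F t" "finite (F t)" by auto
  then show ?case using single.prems by (auto intro: ham_path_fibre)
next
  case (step V y w t)
  show ?case
  proof (cases "t' = t")
    case True
    have "ham_path R (insert t V) t w" by (rule ham_path.step[OF step.hyps])
    \<comment> \<open>\<open>excursion3\<close> wants its end in \<open>C\<close> but allows any
      start. As \<open>z\<close> need not lie in \<open>C\<close>, the excursion is run from
      \<open>z\<close> to \<open>e\<close> and reversed.\<close>
    then show ?thesis unfolding True using step.prems True
      by (intro ham_path_rev[OF excursion3] symp_fibre_adj) auto
  next
    case False
    have "\<not> C \<subseteq> {e, z}"
    proof
      assume "C \<subseteq> {e, z}"
      then have "card C \<le> card {e, z}" by (intro card_mono) auto
      also have "\<dots> \<le> 2" by (simp add: card_insert_if)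
      finally show False using step.prems by simp
    qed
    \<comment> \<open>Avoiding \<open>z\<close> keeps entry and target distinct in case the next
      fibre is the one over \<open>t'\<close>.\<close>
    then obtain d where d: "d \<in> C" "d \<noteq> e" "d \<noteq> z" by auto
    have "ham_path (fibre_adj R) (Sigma {t} F) (t, e) (t, d)"
      using step.prems d by (intro ham_path_fibre) auto
    moreover have "ham_path (fibre_adj R) (Sigma V F) (y, d) (t', z)"
      using step.IH[of d] step.prems d False by auto
    ultimately show ?thesis
      using ham_path_fibre_join[of R "{t}" F "(t, e)" t d V y] step.hyps by auto
  qed
qed

text \<open>First comes an excursion over the side of \<open>t\<close> that avoids
  \<open>t'\<close>, then a zigzag over the other side. Both end points are free as long as they lie
  in different fibres.\<close>

lemma ham_path_fibre_cross3:
  assumes "ham_path R V p q" "symp R" "\<And>t. t \<in> V \<Longrightarrow> finite (F t) \<and> C \<subseteq> F t" "card C = 3"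
    "t \<in> V" "x \<in> F t" "t' \<in> V" "z \<in> F t'" "t \<noteq> t'"
  shows "ham_path (fibre_adj R) (Sigma V F) (t, x) (t', z)"
proof -
  obtain A B w t1 w' where *: "ham_path R A t w" "R t t1" "ham_path R B t1 w'" "t' \<in> B" "V = A \<union> B" "A \<inter> B = {}"
    using ham_path_split2[OF assms(1,5,7,9,2)] .
  have "\<not> C \<subseteq> {x, z}"
  proof
    assume "C \<subseteq> {x, z}"
    then have "card C \<le> card {x, z}" by (intro card_mono) auto
    also have "\<dots> \<le> 2" by (simp add: card_insert_if)
    finally show False using assms by simp
  qed
  then obtain d where d: "d \<in> C" "d \<noteq> x" "d \<noteq> z" by auto
  have "ham_path (fibre_adj R) (Sigma A F) (t, x) (t, d)"
    using * d assms by (intro excursion3[OF *(1), where C = C]) auto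
  moreover have "ham_path (fibre_adj R) (Sigma B F) (t1, d) (t', z)"
    using * d assms by (intro zigzag3[OF *(3), where C = C]) auto
  ultimately show ?thesis using ham_path_fibre_join[of R A F "(t, x)" t d B t1] * by auto
qed


section \<open>Parent maps and their flips\<close>

definition parent_flip :: "('a \<Rightarrow> 'a) \<Rightarrow> ('a \<Rightarrow> 'a) \<Rightarrow> bool" where
  "parent_flip p q \<longleftrightarrow> p \<noteq> q \<and> (\<exists>x y. q = p(x := y))"

text \<open>
  All vertices outside \<open>U\<close> act as roots: contracting \<open>v\<close> is passing from \<open>U\<close> to \<open>U - {v}\<close> with the
  same \<open>E\<close>. The last conjunct excludes directed cycles.
\<close>

definition ptree :: "('a \<times> 'a) set \<Rightarrow> 'a set \<Rightarrow> ('a \<Rightarrow> 'a) set" where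
  "ptree E U = {p. (\<forall>x\<in>U. (p x, x) \<in> E) \<and> (\<forall>x. x \<notin> U \<longrightarrow> p x = undefined) \<and>
    (\<forall>S\<subseteq>U. S \<noteq> {} \<longrightarrow> (\<exists>x\<in>S. p x \<notin> S))}"

lemma symp_parent_flip: "symp parent_flip"
proof (rule sympI)
  fix p q :: "'a \<Rightarrow> 'a"
  assume "parent_flip p q"
  then obtain x y where "q = p(x := y)" "p \<noteq> q" by (auto simp: parent_flip_def)
  then show "parent_flip q p" unfolding parent_flip_def
    by (intro conjI exI[of _ x] exI[of _ "p x"]) auto
qed

lemma parent_flip_update: "y \<noteq> p x \<Longrightarrow> parent_flip p (p(x := y))"
  unfolding parent_flip_def by (metis fun_upd_same)

lemma fun_upd_cancel: "p(v := x) = q(v := y) \<Longrightarrow> p v = q v \<Longrightarrow> p = q"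
  by (metis fun_upd_triv fun_upd_upd)

lemma parent_flip_fun_upd:
  assumes "parent_flip p q" "p v = q v"
  shows "parent_flip (p(v := y)) (q(v := y))"
proof -
  obtain z w where q: "q = p(z := w)" "p \<noteq> q" using assms(1) by (auto simp: parent_flip_def)
  then have "z \<noteq> v" using assms(2) by auto
  then have "q(v := y) = p(v := y, z := w)" unfolding q by (simp add: fun_upd_twist)
  then show ?thesis using fun_upd_cancel[of p v y q y] assms(2) q(2) unfolding parent_flip_def by blast
qed

lemma ham_path_finite: "ham_path R V x y \<Longrightarrow> finite V"
  by (induction rule: ham_path.induct) auto

section \<open>Restricting and extending acyclic parent maps\<close>

lemma ptreeI:
  assumes "\<And>x. x \<in> U \<Longrightarrow> (p x, x) \<in> E" "\<And>x. x \<notin> U \<Longrightarrow> p x = undefined"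
    "\<And>S. S \<subseteq> U \<Longrightarrow> S \<noteq> {} \<Longrightarrow> (\<And>x. x \<in> S \<Longrightarrow> p x \<in> S) \<Longrightarrow> False"
  shows "p \<in> ptree E U"
  unfolding ptree_def using assms by blast

lemma ptree_arc: "p \<in> ptree E U \<Longrightarrow> x \<in> U \<Longrightarrow> (p x, x) \<in> E"
  by (simp add: ptree_def)

lemma ptree_outside: "p \<in> ptree E U \<Longrightarrow> x \<notin> U \<Longrightarrow> p x = undefined"
  by (simp add: ptree_def)

lemma ptree_exit:
  assumes "p \<in> ptree E U" "S \<subseteq> U" "S \<noteq> {}"
  obtains x where "x \<in> S" "p x \<notin> S"
  using assms unfolding ptree_def by blast

lemma ptree_restrict:
  assumes "p \<in> ptree E U"
  shows "p(v := undefined) \<in> ptree E (U - {v})"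
proof (rule ptreeI)
  fix S assume S: "S \<subseteq> U - {v}" "S \<noteq> {}" "\<And>x. x \<in> S \<Longrightarrow> (p(v := undefined)) x \<in> S"
  then have "S \<subseteq> U" by blast
  then obtain x where "x \<in> S" "p x \<notin> S" by (rule ptree_exit[OF assms _ S(2)])
  then show False using S(1) S(3)[of x] by (cases "x = v") auto
qed (use ptree_arc[OF assms] ptree_outside[OF assms] in auto)

text \<open>A closed set missing \<open>v\<close> would already be closed for \<open>p\<close>, so
  the only possible obstruction is a closed set through \<open>v\<close>, which then contains
  \<open>y\<close>.\<close>

lemma ptree_extend:
  assumes "p \<in> ptree E (U - {v})" "v \<in> U" "(y, v) \<in> E"
    and "\<And>S. S \<subseteq> U \<Longrightarrow> v \<in> S \<Longrightarrow> y \<in> S \<Longrightarrow> (\<And>x. x \<in> S - {v} \<Longrightarrow> p x \<in> S) \<Longrightarrow> False"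
  shows "p(v := y) \<in> ptree E U"
proof (rule ptreeI)
  fix S assume S: "S \<subseteq> U" "S \<noteq> {}" "\<And>x. x \<in> S \<Longrightarrow> (p(v := y)) x \<in> S"
  show False
  proof (cases "v \<in> S")
    case True
    show False
    proof (rule assms(4)[OF S(1) True])
      show "y \<in> S" using S(3)[OF True] by simp
      show "p x \<in> S" if "x \<in> S - {v}" for x using S(3)[of x] that by simp
    qed
  next
    case False
    then have "S \<subseteq> U - {v}" using S(1) by blast
    then obtain x where "x \<in> S" "p x \<notin> S" by (rule ptree_exit[OF assms(1) _ S(2)])
    then show False using S(3)[of x] False by (auto split: if_splits)
  qed
qed (use assms(2,3) ptree_arc[OF assms(1)] ptree_outside[OF assms(1)] in auto)

lemma ptree_extend_root:
  "p \<in> ptree E (U - {v}) \<Longrightarrow> v \<in> U \<Longrightarrow> (y, v) \<in> E \<Longrightarrow> y \<notin> U \<Longrightarrow> p(v := y) \<in> ptree E U"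
  by (erule ptree_extend) blast+

lemma ptree_reroot:
  assumes "p \<in> ptree E U" "v \<in> U" "(y, v) \<in> E" "y \<notin> U"
  shows "p(v := y) \<in> ptree E U"
  using ptree_extend_root[OF ptree_restrict[OF assms(1)] assms(2-)] by simp

text \<open>Two parent steps from \<open>u\<close> lead out of \<open>U\<close> without meeting
  \<open>c\<close>, so making \<open>u\<close> the parent of \<open>c\<close> closes no directed
  cycle.\<close>

lemma ptree_extend_grandchild:
  assumes "p \<in> ptree E (U - {c})" "c \<in> U" "(u, c) \<in> E" "u \<noteq> c" "p u \<noteq> c" "p (p u) \<notin> U"
  shows "p(c := u) \<in> ptree E U"
proof (rule ptree_extend[OF assms(1-3)])
  fix S assume "S \<subseteq> U" "u \<in> S" "\<And>x. x \<in> S - {c} \<Longrightarrow> p x \<in> S"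
  moreover have "p u \<in> S" "p (p u) \<in> S" using calculation assms(4,5) by simp_all
  ultimately show False using assms(6) by blast
qed

lemma ptree_extend_leaf:
  assumes "p \<in> ptree E (U - {v})" "v \<in> U" "(y, v) \<in> E" "y \<noteq> v" "\<And>u. u \<in> U - {v} \<Longrightarrow> (v, u) \<notin> E"
  shows "p(v := y) \<in> ptree E U"
proof (rule ptree_extend[OF assms(1-3)])
  fix S assume S: "S \<subseteq> U" "v \<in> S" "y \<in> S" "\<And>x. x \<in> S - {v} \<Longrightarrow> p x \<in> S"
  obtain x where x: "x \<in> S - {v}" "p x \<notin> S - {v}"
    using ptree_exit[OF assms(1), of "S - {v}"] S assms(4) by blast
  then have "p x = v" using S by blast
  then show False using ptree_arc[OF assms(1), of x] x S assms(5)[of x] by auto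
qed

text \<open>Only the parent of \<open>v\<close> is recorded, not the extended map, so that fibres
  over different \<open>p\<close> can share elements as \<open>fibre_adj\<close> requires.\<close>

definition fibre :: "('a \<times> 'a) set \<Rightarrow> 'a set \<Rightarrow> 'a \<Rightarrow> ('a \<Rightarrow> 'a) \<Rightarrow> 'a set" where
  "fibre E U v p = {y. p(v := y) \<in> ptree E U}"

lemma finite_fibre:
  assumes "finite E" "v \<in> U"
  shows "finite (fibre E U v p)"
proof (rule finite_subset)
  show "fibre E U v p \<subseteq> fst ` E"
    using assms ptree_arc[of "p(v := _)" E U v] by (force simp: fibre_def)
qed (use assms in simp)

text \<open>Splitting off the parent of \<open>v\<close> is a bijection from
  \<open>ptree E U\<close> to the pairs. Adjacency inside a fibre becomes a flip at
  \<open>v\<close>, adjacency between fibres a flip elsewhere.\<close>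

lemma ham_path_ptree_fibre:
  assumes "v \<in> U"
    and "ham_path (fibre_adj parent_flip) (Sigma (ptree E (U - {v})) (fibre E U v)) (p, x) (q, y)"
  shows "ham_path parent_flip (ptree E U) (p(v := x)) (q(v := y))"
proof -
  let ?f = "\<lambda>(p, y). p(v := y)" and ?S = "Sigma (ptree E (U - {v})) (fibre E U v)"
  have und: "p v = undefined" if "p \<in> ptree E (U - {v})" for p
    using ptree_outside[OF that] by simp
  have "ham_path parent_flip (?f ` ?S) (?f (p, x)) (?f (q, y))"
  proof (rule ham_path_image[OF assms(2)])
    show "inj_on ?f ?S"
      by (rule inj_onI) (auto simp: und dest: fun_upd_cancel fun_upd_eqD)
    fix a b assume ab: "a \<in> ?S" "b \<in> ?S" "fibre_adj parent_flip a b"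
    obtain p x q y where a: "a = (p, x)" and b: "b = (q, y)" by (cases a, cases b)
    show "parent_flip (?f a) (?f b)"
    proof (cases "p = q")
      case True
      then have "x \<noteq> y" using ab a b by (auto simp: fibre_adj_def parent_flip_def)
      then show ?thesis using parent_flip_update[of y "p(v := x)" v] a b True by simp
    next
      case False
      then have "parent_flip p q" "x = y" using ab a b by (auto simp: fibre_adj_def)
      moreover have "p v = q v" using ab a b und[of p] und[of q] by auto
      ultimately show ?thesis using a b parent_flip_fun_upd[of p q v y] by simp
    qed
  qed
  moreover have "?f ` ?S = ptree E U"
  proof (intro equalityI subsetI)
    fix p assume "p \<in> ptree E U"
    then show "p \<in> ?f ` ?S" using ptree_restrict[of p E U v]
      by (intro image_eqI[of _ _ "(p(v := undefined), p v)"]) (auto simp: fibre_def)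
  qed (auto simp: fibre_def)
  ultimately show ?thesis by simp
qed

lemma ham_path_ptree_contract:
  assumes "ham_path parent_flip (ptree E (U - {c})) p q" "(\<rho>, c) \<in> E" "c \<in> U" "\<rho> \<notin> U"
  shows "ham_path parent_flip {p \<in> ptree E U. p c = \<rho>} (p(c := \<rho>)) (q(c := \<rho>))"
proof -
  let ?f = "\<lambda>p. p(c := \<rho>)"
  have und: "p c = undefined" if "p \<in> ptree E (U - {c})" for p
    using ptree_outside[OF that] by simp
  have "ham_path parent_flip (?f ` ptree E (U - {c})) (?f p) (?f q)"
  proof (rule ham_path_image[OF assms(1)])
    show "inj_on ?f (ptree E (U - {c}))"
      by (rule inj_onI) (auto simp: und dest: fun_upd_cancel)
    show "parent_flip (?f p) (?f q)"
      if "p \<in> ptree E (U - {c})" "q \<in> ptree E (U - {c})" "parent_flip p q" for p q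
      using that und[OF that(1)] und[OF that(2)] by (intro parent_flip_fun_upd) auto
  qed
  moreover have "?f ` ptree E (U - {c}) = {p \<in> ptree E U. p c = \<rho>}"
  proof (intro equalityI subsetI)
    fix p assume "p \<in> {p \<in> ptree E U. p c = \<rho>}"
    then show "p \<in> ?f ` ptree E (U - {c})" using ptree_restrict[of p E U c]
      by (intro image_eqI[of _ _ "p(c := undefined)"]) auto
  qed (use assms ptree_extend_root in auto)
  ultimately show ?thesis by simp
qed

lemma ptree_delete:
  assumes "c \<in> U"
  shows "ptree (E - {(\<rho>, c)}) U = {p \<in> ptree E U. p c \<noteq> \<rho>}"
  using assms by (auto simp: ptree_def)

text \<open>Once the vertices outside \<open>U\<close> are merged into the root, these are two
  parallel arcs from the root to \<open>v\<close>.\<close>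

definition double_root_arc :: "('a \<times> 'a) set \<Rightarrow> 'a set \<Rightarrow> bool" where
  "double_root_arc E U \<longleftrightarrow> (\<exists>v\<in>U. \<exists>r r'. r \<noteq> r' \<and> r \<notin> U \<and> r' \<notin> U \<and> (r, v) \<in> E \<and> (r', v) \<in> E)"

text \<open>This is the induction statement. Quantifying over \<open>p\<close> makes it vacuous if
  the flip graph is empty; \<open>p\<close> is a prescribed start only in the presence of a double
  root arc.\<close>

definition flips_traceable :: "('a \<times> 'a) set \<Rightarrow> 'a set \<Rightarrow> bool" where
  "flips_traceable E U \<longleftrightarrow> (\<forall>p\<in>ptree E U. \<exists>s t. ham_path parent_flip (ptree E U) s t \<and> (double_root_arc E U \<longrightarrow> s = p))"

lemma double_root_arcI:
  "v \<in> U \<Longrightarrow> r \<noteq> r' \<Longrightarrow> r \<notin> U \<Longrightarrow> r' \<notin> U \<Longrightarrow> (r, v) \<in> E \<Longrightarrow> (r', v) \<in> E \<Longrightarrow> double_root_arc E U"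
  unfolding double_root_arc_def by blast

lemma flips_traceableD:
  assumes "flips_traceable E U" "p \<in> ptree E U"
  obtains s t where "ham_path parent_flip (ptree E U) s t"
  using assms unfolding flips_traceable_def by blast

lemma flips_traceable_start:
  assumes "flips_traceable E U" "p \<in> ptree E U" "double_root_arc E U"
  obtains t where "ham_path parent_flip (ptree E U) p t"
  using assms unfolding flips_traceable_def by blast

text \<open>The path through the maps without the arc ends at some \<open>q\<close>. Changing the
  parent of \<open>c\<close> to \<open>\<rho>\<close> there is one flip, and the double root arc
  lets the path through the other maps start at the result.\<close>

lemma ham_path_contract_delete:
  assumes "ham_path parent_flip (ptree (E - {(\<rho>, c)}) U) s q" "(\<rho>, c) \<in> E" "c \<in> U" "\<rho> \<notin> U"
    and "flips_traceable E (U - {c})" "double_root_arc E (U - {c})"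
  shows "\<exists>t. ham_path parent_flip (ptree E U) s t"
proof -
  have q: "q \<in> ptree E U" "q c \<noteq> \<rho>" using ham_path_mem[OF assms(1)] ptree_delete[OF assms(3)] by auto
  obtain t where "ham_path parent_flip (ptree E (U - {c})) (q(c := undefined)) t"
    using flips_traceable_start[OF assms(5) ptree_restrict[OF q(1)] assms(6)] .
  from ham_path_ptree_contract[OF this assms(2-4)]
  have *: "ham_path parent_flip {p \<in> ptree E U. p c = \<rho>} (q(c := \<rho>)) (t(c := \<rho>))" by simp
  have "ham_path parent_flip (ptree (E - {(\<rho>, c)}) U \<union> {p \<in> ptree E U. p c = \<rho>}) s (t(c := \<rho>))"
    using q by (intro ham_path_join[OF assms(1) *] parent_flip_update) (auto simp: ptree_delete[OF assms(3)])
  moreover have "ptree (E - {(\<rho>, c)}) U \<union> {p \<in> ptree E U. p c = \<rho>} = ptree E U"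
    by (auto simp: ptree_delete[OF assms(3)])
  ultimately show ?thesis by auto
qed

section \<open>The induction step\<close>

lemma ham_path_ptree_exists:
  assumes "p \<in> ptree E U" "finite U" "\<not> double_root_arc E U"
    and total: "\<And>x y. x \<in> U \<Longrightarrow> y \<in> U \<Longrightarrow> x \<noteq> y \<Longrightarrow> (x, y) \<in> E \<or> (y, x) \<in> E"
    and traceable_contract: "\<And>\<rho> c. c \<in> U \<Longrightarrow> \<rho> \<notin> U \<Longrightarrow> (\<rho>, c) \<in> E \<Longrightarrow> flips_traceable E (U - {c})"
    and traceable_delete: "\<And>\<rho> c. c \<in> U \<Longrightarrow> \<rho> \<notin> U \<Longrightarrow> (\<rho>, c) \<in> E \<Longrightarrow> flips_traceable (E - {(\<rho>, c)}) U"
  shows "\<exists>s t. ham_path parent_flip (ptree E U) s t"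
proof (cases "U = {}")
  case True
  then have "ptree E U = {\<lambda>_. undefined}" by (auto simp: ptree_def)
  then show ?thesis using ham_path.single[of parent_flip] by auto
next
  case False
  \<comment> \<open>A root arc is suitable if every parent map uses it or if its contraction creates
    a double root arc.\<close>
  have main: ?thesis if a: "a \<in> U" "\<rho> \<notin> U" "(\<rho>, a) \<in> E"
    and *: "ptree (E - {(\<rho>, a)}) U = {} \<or> double_root_arc E (U - {a})" for a \<rho>
  proof (cases "ptree (E - {(\<rho>, a)}) U = {}")
    case True
    then have "{p \<in> ptree E U. p a = \<rho>} = ptree E U" using ptree_delete[OF a(1)] by auto
    moreover obtain s t where "ham_path parent_flip (ptree E (U - {a})) s t"
      using flips_traceableD[OF traceable_contract[OF a] ptree_restrict[OF assms(1)]] .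
    ultimately show ?thesis using ham_path_ptree_contract[of E U a s t \<rho>] a by auto
  next
    case False
    then obtain s q where "ham_path parent_flip (ptree (E - {(\<rho>, a)}) U) s q"
      using flips_traceableD[OF traceable_delete[OF a]] by blast
    then show ?thesis using ham_path_contract_delete[of E \<rho> a U s q] traceable_contract[OF a] a * False by blast
  qed
  obtain a where a: "a \<in> U" "p a \<notin> U" using ptree_exit[OF assms(1) order_refl False] .
  note pa = ptree_arc[OF assms(1) a(1)]
  show ?thesis
  proof (cases "\<exists>b \<sigma>. b \<in> U \<and> b \<noteq> a \<and> \<sigma> \<notin> U \<and> (\<sigma>, b) \<in> E")
    case True
    then obtain b \<sigma> where b: "b \<in> U" "b \<noteq> a" "\<sigma> \<notin> U" "(\<sigma>, b) \<in> E" by blast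
    show ?thesis
    proof (cases "(a, b) \<in> E")
      case True
      \<comment> \<open>Contracting \<open>a\<close> makes it a root, so \<open>b\<close> has root
        arcs from \<open>a\<close> and \<open>\<sigma>\<close>. In the other case the arc goes from
        \<open>b\<close> to \<open>a\<close>, and \<open>b\<close> is contracted instead.\<close>
      then have "double_root_arc E (U - {a})" using a b by (intro double_root_arcI[of b _ a \<sigma>]) auto
      then show ?thesis using main[OF a pa] by blast
    next
      case False
      then have "double_root_arc E (U - {b})" using a b total[of a b] pa by (intro double_root_arcI[of a _ b "p a"]) auto
      then show ?thesis using main[OF b(1,3,4)] by blast
    qed
  next
    case no_b: False
    \<comment> \<open>As \<open>a\<close> is the only root child and has no second root arc, every
      parent map uses this arc.\<close>
    have "ptree (E - {(p a, a)}) U = {}"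
    proof (rule ccontr)
      assume "ptree (E - {(p a, a)}) U \<noteq> {}"
      then obtain q where q: "q \<in> ptree E U" "q a \<noteq> p a" using ptree_delete[OF a(1)] by auto
      obtain x where x: "x \<in> U" "q x \<notin> U" using ptree_exit[OF q(1) order_refl False] .
      then have "x = a" using no_b ptree_arc[OF q(1) x(1)] by blast
      then have "double_root_arc E U" using a x q(2) pa ptree_arc[OF q(1) x(1)]
        by (intro double_root_arcI[of a _ "q a" "p a"]) auto
      then show False using assms(3) by simp
    qed
    then show ?thesis using main[OF a pa] by blast
  qed
qed

text \<open>
  The hard case for a prescribed start: \<open>v\<close> has two root arcs and \<open>c\<close> is a root child with an arc to
  \<open>v\<close>. Over the contraction of both, the flip graph with \<open>c\<close> contracted has the three common fibre
  elements \<open>r1\<close>, \<open>r2\<close> and \<open>c\<close>. This leaves enough freedom to end its path next to an arborescence in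
  which \<open>c\<close> has another parent than \<open>\<rho>\<close>, from where these remaining arborescences are visited.
\<close>

lemma ham_path_ptree_start_second_root_child:
  assumes s: "s \<in> ptree E U" and fin: "finite E"
    and r: "v \<in> U" "r1 \<noteq> r2" "r1 \<notin> U" "r2 \<notin> U" "(r1, v) \<in> E" "(r2, v) \<in> E"
    and total: "\<And>x y. x \<in> U \<Longrightarrow> y \<in> U \<Longrightarrow> x \<noteq> y \<Longrightarrow> (x, y) \<in> E \<or> (y, x) \<in> E"
    and c: "c \<in> U" "c \<noteq> v" "\<rho> \<notin> U" "(\<rho>, c) \<in> E" "(v, c) \<notin> E"
    and u: "u \<in> U" "u \<noteq> v" "(v, u) \<in> E"
    and traceable: "flips_traceable E (U - {c})" "flips_traceable E (U - {c} - {v})" "flips_traceable (E - {(\<rho>, c)}) U"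
  shows "\<exists>t. ham_path parent_flip (ptree E U) s t"
proof -
  let ?D = "ptree (E - {(\<rho>, c)}) U" and ?C = "ptree E (U - {c})" and ?K = "ptree E (U - {c} - {v})"
  let ?F = "fibre E (U - {c}) v"
  note D_eq = ptree_delete[OF c(1), of E \<rho>]
  have cv: "(c, v) \<in> E" using total[of c v] c r by auto
  have uc: "u \<noteq> c" using u c by auto
  have dC: "double_root_arc E (U - {c})" using r c by (intro double_root_arcI[of v _ r1 r2]) auto
  have dD: "double_root_arc (E - {(\<rho>, c)}) U" using r c by (intro double_root_arcI[of v _ r1 r2]) auto
  show ?thesis
  proof (cases "s c = \<rho>")
    case False
    then have "s \<in> ?D" using s D_eq by simp
    then obtain q where "ham_path parent_flip ?D s q" using flips_traceable_start[OF traceable(3) _ dD] by blast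
    then show ?thesis by (rule ham_path_contract_delete[OF _ c(4,1,3) traceable(1) dC])
  next
    case sc: True
    \<comment> \<open>Since \<open>s\<close> uses the arc from \<open>\<rho>\<close> to
      \<open>c\<close>, the contracted part is visited first and \<open>?D\<close> last.\<close>
    define S where "S = s(c := undefined)"
    define T where "T = S(v := undefined)"
    have S: "S \<in> ?C" "S(c := \<rho>) = s" using ptree_restrict[OF s] sc by (auto simp: S_def fun_upd_idem)
    have T: "T \<in> ?K" "T(v := s v) = S" using ptree_restrict[OF S(1)] c by (auto simp: T_def S_def fun_upd_idem)
    show ?thesis
    proof (cases "?D = {}")
      case True
      then have "{p \<in> ptree E U. p c = \<rho>} = ptree E U" using D_eq by auto
      moreover obtain t where "ham_path parent_flip ?C S t"
        using flips_traceable_start[OF traceable(1) S(1) dC] .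
      ultimately show ?thesis using ham_path_ptree_contract[of E U c S t \<rho>] c S by auto
    next
      case False
      let ?R = "{r1, r2, c}"
      have R: "finite (?F p) \<and> ?R \<subseteq> ?F p" if p: "p \<in> ?K" for p
      proof -
        have "j \<in> ?F p" if "j \<in> ?R" for j
          unfolding fibre_def mem_Collect_eq by (rule ptree_extend_root[OF p]) (use that r c cv in auto)
        then show ?thesis using finite_fibre[OF fin, of v "U - {c}" p] r c by blast
      qed
      have "r1 \<noteq> c" "r2 \<noteq> c" using r c by auto
      then have cardR: "card ?R = 3" using r(2) by simp
      have sv: "s v \<in> ?F T" using S(1) by (simp add: fibre_def T(2))
      define \<pi> where "\<pi> q = q(c := undefined, v := undefined)" for q :: "'a \<Rightarrow> 'a"
      have \<pi>: "\<pi> q \<in> ?K" if "q \<in> ?D" for q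
        using ptree_restrict[OF ptree_restrict, of q E U c v] that unfolding D_eq \<pi>_def by blast
      \<comment> \<open>The end should lie over some \<open>q\<close> in \<open>?D\<close>, with a
        root \<open>j\<close> as parent of \<open>v\<close>: then \<open>q(v := j)\<close> is again
        in \<open>?D\<close> and one flip at \<open>c\<close> away.\<close>
      have "\<exists>q\<in>?D. \<exists>j\<in>{r1, r2}. ham_path parent_flip ?C S ((\<pi> q)(v := j))"
      proof (cases "\<exists>q\<in>?D. \<pi> q \<noteq> T")
        case True
        then obtain q where q: "q \<in> ?D" "\<pi> q \<noteq> T" by blast
        obtain a b where ab: "ham_path parent_flip ?K a b" using flips_traceableD[OF traceable(2) T(1)] .
        have "r1 \<in> ?F (\<pi> q)" using R[OF \<pi>[OF q(1)]] by simp
        from ham_path_fibre_cross3[where F = ?F and C = ?R, OF ab symp_parent_flip R cardR T(1) sv \<pi>[OF q(1)] this q(2)[symmetric]]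
        have "ham_path (fibre_adj parent_flip) (Sigma ?K ?F) (T, s v) (\<pi> q, r1)" by simp
        then have "ham_path parent_flip ?C S ((\<pi> q)(v := r1))"
          using ham_path_ptree_fibre[of v "U - {c}" E T "s v" "\<pi> q" r1] r(1) c(2) T(2) by simp
        then show ?thesis using q by blast
      next
        case all_T: False
        \<comment> \<open>All of \<open>?D\<close> lies over \<open>T\<close>, so the path must end
          in the fibre where it starts. An excursion does this, given a base path starting at
          \<open>T\<close>.\<close>
        have "\<exists>b. ham_path parent_flip ?K T b"
        proof (cases "(c, u) \<in> E")
          case True
          then have "double_root_arc E (U - {c} - {v})" using u c uc by (intro double_root_arcI[of u _ c v]) auto
          then show ?thesis using flips_traceable_start[OF traceable(2) T(1)] by blast
        next
          case False
          then have "(u, c) \<in> E" using total[of u c] u c uc by blast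
          \<comment> \<open>Every \<open>p(u := v)\<close> extends to an element of \<open>?D\<close>, so by \<open>all_T\<close> only the parent of \<open>u\<close> varies and \<open>?K\<close> is a clique.\<close>
          have up: "p(u := v) = T" if p: "p \<in> ?K" for p
          proof -
            have 1: "p(u := v) \<in> ?K" using u uc by (intro ptree_reroot[OF p]) auto
            have 2: "p(u := v, v := r1) \<in> ?C" using r c by (intro ptree_extend_root[OF 1]) auto
            have 3: "p(u := v, v := r1, c := u) \<in> ptree E U"
              using c u uc r \<open>(u, c) \<in> E\<close> by (intro ptree_extend_grandchild[OF 2]) auto
            then have 4: "p(u := v, v := r1, c := u) \<in> ?D" using D_eq u c by auto
            have "p v = undefined" "p c = undefined" using p ptree_outside by fastforce+
            then have "\<pi> (p(u := v, v := r1, c := u)) = p(u := v)"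
              using u uc c by (auto simp: \<pi>_def)
            then show ?thesis using all_T 4 by auto
          qed
          have adj: "parent_flip p q" if "p \<in> ?K" "q \<in> ?K" "p \<noteq> q" for p q
          proof -
            have "p(u := v) = q(u := v)" using up that by simp
            then have "q = p(u := q u)" by (metis fun_upd_triv fun_upd_upd)
            then show ?thesis using that unfolding parent_flip_def by blast
          qed
          show ?thesis
          proof (cases "?K = {T}")
            case True
            then show ?thesis using ham_path.single[of parent_flip T] by auto
          next
            case False
            then obtain p where p: "p \<in> ?K" "p \<noteq> T" using T by auto
            have "finite ?K" using flips_traceableD[OF traceable(2) T(1)] ham_path_finite by metis
            then show ?thesis using ham_path_clique[of ?K T p parent_flip] p T adj by blast
          qed
        qed
        then obtain b where b: "ham_path parent_flip ?K T b" ..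
        obtain j where j: "j \<in> {r1, r2}" "j \<noteq> s v" using r by auto
        have "ham_path (fibre_adj parent_flip) (Sigma ?K ?F) (T, s v) (T, j)"
          by (rule excursion3[where F = ?F and C = ?R, OF b symp_parent_flip R cardR sv]) (use j in auto)
        then have "ham_path parent_flip ?C S (T(v := j))"
          using ham_path_ptree_fibre[of v "U - {c}" E T "s v" T j] r(1) c(2) T(2) by simp
        then show ?thesis using j False all_T by auto
      qed
      then obtain q j where q: "q \<in> ?D" "j \<in> {r1, r2}" "ham_path parent_flip ?C S ((\<pi> q)(v := j))" by blast
      let ?q = "q(v := j)"
      have "?q \<in> ?D" using q r c D_eq ptree_reroot[of q E U v j] by auto
      then obtain t where t: "ham_path parent_flip ?D ?q t" using flips_traceable_start[OF traceable(3) _ dD] by blast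
      have "(\<pi> q)(v := j, c := \<rho>) = ?q(c := \<rho>)" using c by (auto simp: \<pi>_def)
      then have C: "ham_path parent_flip {p \<in> ptree E U. p c = \<rho>} s (?q(c := \<rho>))"
        using ham_path_ptree_contract[OF q(3) c(4,1,3)] S by simp
      have "?q c \<noteq> \<rho>" using \<open>?q \<in> ?D\<close> D_eq by blast
      then have "parent_flip (?q(c := \<rho>)) ?q"
        using sympD[OF symp_parent_flip] parent_flip_update[of \<rho> ?q c] by metis
      then have "ham_path parent_flip ({p \<in> ptree E U. p c = \<rho>} \<union> ?D) s t"
        by (intro ham_path_join[OF C t]) (auto simp: D_eq)
      moreover have "{p \<in> ptree E U. p c = \<rho>} \<union> ?D = ptree E U" by (auto simp: D_eq)
      ultimately show ?thesis by auto
    qed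
  qed
qed

text \<open>The path is lifted from the contraction of \<open>v\<close> whenever that has a double
  root arc (zigzag), the fibres have a third common element, or they have exactly two elements. The
  third element is a root child \<open>c\<close> if \<open>v\<close> has no arc into
  \<open>U - {v}\<close>, or another root. The remaining case is the preceding lemma.\<close>

lemma ham_path_ptree_start:
  assumes s: "s \<in> ptree E U" and fin: "finite E" and dbl: "double_root_arc E U"
    and total: "\<And>x y. x \<in> U \<Longrightarrow> y \<in> U \<Longrightarrow> x \<noteq> y \<Longrightarrow> (x, y) \<in> E \<or> (y, x) \<in> E"
    and traceable_contract: "\<And>\<rho> c. c \<in> U \<Longrightarrow> \<rho> \<notin> U \<Longrightarrow> (\<rho>, c) \<in> E \<Longrightarrow> flips_traceable E (U - {c})"
    and traceable_contract2: "\<And>\<rho> c v. c \<in> U \<Longrightarrow> \<rho> \<notin> U \<Longrightarrow> (\<rho>, c) \<in> E \<Longrightarrow> flips_traceable E (U - {c} - {v})"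
    and traceable_delete: "\<And>\<rho> c. c \<in> U \<Longrightarrow> \<rho> \<notin> U \<Longrightarrow> (\<rho>, c) \<in> E \<Longrightarrow> flips_traceable (E - {(\<rho>, c)}) U"
  shows "\<exists>t. ham_path parent_flip (ptree E U) s t"
proof -
  obtain v r1 r2 where r: "v \<in> U" "r1 \<noteq> r2" "r1 \<notin> U" "r2 \<notin> U" "(r1, v) \<in> E" "(r2, v) \<in> E"
    using dbl unfolding double_root_arc_def by blast
  let ?H = "ptree E (U - {v})" and ?F = "fibre E U v"
  define T where "T = s(v := undefined)"
  have T: "T \<in> ?H" "T(v := s v) = s" using ptree_restrict[OF s] by (auto simp: T_def)
  have sv: "s v \<in> ?F T" using s by (simp add: fibre_def T(2))
  note traceableH = traceable_contract[OF r(1,3,5)]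
  have R: "finite (?F p) \<and> {r1, r2} \<subseteq> ?F p" if "p \<in> ?H" for p
    using that r finite_fibre[OF fin r(1)] by (auto simp: fibre_def intro!: ptree_extend_root)
  have lift: ?thesis if "ham_path (fibre_adj parent_flip) (Sigma ?H ?F) (T, s v) w" for w
    using ham_path_ptree_fibre[OF r(1), of E T "s v" "fst w" "snd w"] that T(2) by auto
  obtain y z where yz: "ham_path parent_flip ?H y z" using flips_traceableD[OF traceableH T(1)] .
  have third: ?thesis if e: "e \<notin> {r1, r2}" "\<And>p. p \<in> ?H \<Longrightarrow> e \<in> ?F p" for e
  proof (cases "?H = {T}")
    case True
    obtain d where "d \<in> {r1, r2}" "d \<noteq> s v" using r by auto
    then have "ham_path (fibre_adj parent_flip) (Sigma {T} ?F) (T, s v) (T, d)"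
      using R[OF T(1)] sv by (intro ham_path_fibre) auto
    then show ?thesis using lift True by simp
  next
    case False
    then obtain T' where T': "T' \<in> ?H" "T' \<noteq> T" using T by auto
    have R3: "finite (?F p) \<and> {r1, r2, e} \<subseteq> ?F p" if "p \<in> ?H" for p
      using R[OF that] e(2)[OF that] by simp
    have "card {r1, r2, e} = 3" using r(2) e(1) by auto
    from ham_path_fibre_cross3[where F = ?F and C = "{r1, r2, e}", OF yz symp_parent_flip R3 this T(1) sv T'(1) e(2)[OF T'(1)] T'(2)[symmetric]]
    have "ham_path (fibre_adj parent_flip) (Sigma ?H ?F) (T, s v) (T', e)" by simp
    then show ?thesis by (rule lift)
  qed
  show ?thesis
  proof (cases "double_root_arc E (U - {v})")
    case True
    then obtain t where "ham_path parent_flip ?H T t" using flips_traceable_start[OF traceableH T(1)] by blast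
    then obtain w where "ham_path (fibre_adj parent_flip) (Sigma ?H ?F) (T, s v) w"
      using zigzag2[of parent_flip ?H T t "s v" ?F r1 r2] R sv r by blast
    then show ?thesis by (rule lift)
  next
    case simple: False
    show ?thesis
    proof (cases "\<exists>c \<rho>. c \<in> U \<and> c \<noteq> v \<and> \<rho> \<notin> U \<and> (\<rho>, c) \<in> E")
      case True
      then obtain c \<rho> where c: "c \<in> U" "c \<noteq> v" "\<rho> \<notin> U" "(\<rho>, c) \<in> E" by blast
      \<comment> \<open>Otherwise contracting \<open>v\<close> would give \<open>c\<close> root arcs
        from both \<open>v\<close> and \<open>\<rho>\<close>, contrary to
        \<open>simple\<close>.\<close>
      have vc: "(v, c) \<notin> E"
        using simple double_root_arcI[of c "U - {v}" v \<rho> E] c r(1) by auto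
      show ?thesis
      proof (cases "\<exists>u\<in>U - {v}. (v, u) \<in> E")
        case True
        then obtain u where "u \<in> U" "u \<noteq> v" "(v, u) \<in> E" by blast
        then show ?thesis
          using c traceable_contract traceable_contract2 traceable_delete
          by (intro ham_path_ptree_start_second_root_child[OF s fin r total c vc]) auto
      next
        case False
        have "(c, v) \<in> E" using total[of c v] c vc r(1) by auto
        then show ?thesis using False c r
          by (intro third[of c]) (auto simp: fibre_def intro!: ptree_extend_leaf)
      qed
    next
      case no_c: False
      \<comment> \<open>Here \<open>v\<close> is the only possible root child.\<close>
      have exit: "p v \<notin> U" if p: "p \<in> ptree E U" for p
      proof -
        obtain x where x: "x \<in> U" "p x \<notin> U" using ptree_exit[OF p order_refl] r(1) by blast
        then show ?thesis using no_c ptree_arc[OF p x(1)] by metis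
      qed
      show ?thesis
      proof (cases "\<exists>e. e \<notin> U \<and> e \<notin> {r1, r2} \<and> (e, v) \<in> E")
        case True
        then show ?thesis using r third by (auto simp: fibre_def intro!: ptree_extend_root)
      next
        case False
        have F: "?F p = {r1, r2}" if "p \<in> ?H" for p
        proof -
          have "?F p \<subseteq> {r1, r2}"
            using False exit ptree_arc[of _ E U v] r(1) by (force simp: fibre_def)
          then show ?thesis using R[OF that] by blast
        qed
        have "s v = r1 \<or> s v = r2" using sv F[OF T(1)] by simp
        then obtain d where d: "{s v, d} = {r1, r2}" by (metis insert_commute)
        obtain w where "ham_path (fibre_adj parent_flip) (Sigma ?H ?F) (T, s v) w"
          using ham_path_fibre_start2[OF yz symp_parent_flip T(1) d r(2), of ?F] F by blast
        then show ?thesis by (rule lift)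
      qed
    qed
  qed
qed

theorem flips_traceable_ptree:
  assumes "finite E" "finite U"
    and "\<And>x y. x \<in> U \<Longrightarrow> y \<in> U \<Longrightarrow> x \<noteq> y \<Longrightarrow> (x, y) \<in> E \<or> (y, x) \<in> E"
  shows "flips_traceable E U"
  using assms
proof (induction "card {e \<in> E. snd e \<in> U}" arbitrary: E U rule: less_induct)
  case less
  have smaller: "flips_traceable E' U'"
    if "E' \<subseteq> E" "U' \<subseteq> U" "e \<in> E" "snd e \<in> U" "snd e \<notin> U' \<or> e \<notin> E'"
      "\<And>x y. x \<in> U' \<Longrightarrow> y \<in> U' \<Longrightarrow> x \<noteq> y \<Longrightarrow> (x, y) \<in> E' \<or> (y, x) \<in> E'" for E' U' e
  proof (rule less.hyps)
    show "card {e \<in> E'. snd e \<in> U'} < card {e \<in> E. snd e \<in> U}"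
      using that less.prems(1) by (intro psubset_card_mono) auto
    show "finite E'" "finite U'" using that less.prems finite_subset by blast+
  qed (rule that)
  have contract: "flips_traceable E (U - {c} - X)" if "c \<in> U" "(\<rho>, c) \<in> E" for \<rho> c X
    using that less.prems(3) by (intro smaller[of E "U - {c} - X" "(\<rho>, c)"]) auto
  have contract1: "flips_traceable E (U - {c})" if "c \<in> U" "(\<rho>, c) \<in> E" for \<rho> c
    using contract[OF that, of "{}"] by simp
  \<comment> \<open>The deleted arc has its tail outside \<open>U\<close>, so \<open>U\<close> stays
    semicomplete.\<close>
  have delete: "flips_traceable (E - {(\<rho>, c)}) U" if "c \<in> U" "\<rho> \<notin> U" "(\<rho>, c) \<in> E" for \<rho> c
    using that less.prems(3) by (intro smaller[of "E - {(\<rho>, c)}" U "(\<rho>, c)"]) auto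
  show ?case unfolding flips_traceable_def
  proof
    fix p assume p: "p \<in> ptree E U"
    show "\<exists>s t. ham_path parent_flip (ptree E U) s t \<and> (double_root_arc E U \<longrightarrow> s = p)"
    proof (cases "double_root_arc E U")
      case True
      have "\<exists>t. ham_path parent_flip (ptree E U) p t"
        using less.prems contract contract1 delete by (intro ham_path_ptree_start[OF p _ True]) blast+
      then show ?thesis by blast
    next
      case False
      have "\<exists>s t. ham_path parent_flip (ptree E U) s t"
        using less.prems contract1 delete by (intro ham_path_ptree_exists[OF p _ False]) blast+
      then show ?thesis using False by blast
    qed
  qed
qed


section \<open>Arborescences as parent maps\<close>

text \<open>The condition on \<open>r\<close> matters because \<open>p r\<close> is
  \<open>undefined\<close>, which might happen to be an in-neighbour of \<open>r\<close>.\<close>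

definition parent_graph :: "('a, 'b) pre_digraph \<Rightarrow> 'a \<Rightarrow> ('a \<Rightarrow> 'a) \<Rightarrow> ('a, 'b) pre_digraph" where
  "parent_graph G r p = \<lparr>verts = verts G, arcs = {e \<in> arcs G. head G e \<noteq> r \<and> tail G e = p (head G e)},
     tail = tail G, head = head G\<rparr>"

lemma parent_graph_simps [simp]:
  "verts (parent_graph G r p) = verts G"
  "arcs (parent_graph G r p) = {e \<in> arcs G. head G e \<noteq> r \<and> tail G e = p (head G e)}"
  "tail (parent_graph G r p) = tail G" "head (parent_graph G r p) = head G"
  by (simp_all add: parent_graph_def)

lemma ptree_depth:
  assumes "p \<in> ptree E U" "finite U"
  shows "\<exists>d :: 'a \<Rightarrow> nat. \<forall>x\<in>U. d (p x) < d x"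
  using assms(2,1)
proof (induction U arbitrary: p rule: finite_psubset_induct)
  case (psubset U)
  show ?case
  proof (cases "U = {}")
    case False
    then obtain x where x: "x \<in> U" "p x \<notin> U" using ptree_exit[OF psubset.prems order_refl] by blast
    then obtain d :: "'a \<Rightarrow> nat" where d: "\<forall>y\<in>U - {x}. d ((p(x := undefined)) y) < d y"
      using psubset.IH[of "U - {x}", OF _ ptree_restrict[OF psubset.prems]] by blast
    \<comment> \<open>The shift by 2 puts all other vertices of \<open>U\<close> above
      \<open>x\<close>, whose depth is 1, including those with parent \<open>x\<close>.\<close>
    let ?d = "\<lambda>y. if y \<notin> U then 0 else if y = x then 1 else d y + 2"
    have "?d (p y) < ?d y" if "y \<in> U" for y
      using that x d by (cases "y = x") auto
    then show ?thesis by (intro exI[of _ ?d]) blast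
  qed simp
qed

section \<open>Undirected paths and unique parents in arborescences\<close>

context wf_digraph
begin

lemma underlying_path_exists:
  assumes "underlying_tree G" "u \<in> verts G" "v \<in> verts G"
  obtains w where "pre_digraph.apath (mk_symmetric G) u w v"
proof -
  interpret D: pair_wf_digraph "mk_symmetric G" by (rule wellformed_mk_symmetric)
  have "u \<rightarrow>\<^sup>*\<^bsub>mk_symmetric G\<^esub> v"
    using assms by (auto simp: underlying_tree_def connected_def strongly_connected_def)
  then show thesis using that D.reachable_apath by blast
qed

lemma no_long_cycle:
  assumes "underlying_tree G" "pre_digraph.awalk (mk_symmetric G) u w u"
    "distinct (map snd w)" "length w \<ge> 3"
  shows False
proof -
  interpret D: pair_wf_digraph "mk_symmetric G" by (rule wellformed_mk_symmetric)
  have "w \<noteq> []" using assms(4) by auto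
  then have "tl (pawalk_verts u w) = map snd w"
    using assms(2) D.awalk_verts_conv'[of u w u] by (auto simp: D.awalk_def)
  then have "D.cycle w" using assms(2,3) \<open>w \<noteq> []\<close> unfolding D.cycle_def by metis
  then show False using assms by (auto simp: underlying_tree_def underlying_forest_def)
qed

lemma path_from_root_arc:
  assumes "\<And>e. e \<in> arcs G \<Longrightarrow> oriented_away G r e"
    and "pre_digraph.apath (mk_symmetric G) r w x" "(a, b) \<in> set w"
  shows "\<exists>e\<in>arcs G. tail G e = a \<and> head G e = b"
proof -
  interpret D: pair_wf_digraph "mk_symmetric G" by (rule wellformed_mk_symmetric)
  have "(a, b) \<in> parcs (mk_symmetric G)"
    using assms(2,3) by (auto simp: D.apath_def D.awalk_def)
  then obtain e where e: "e \<in> arcs G" "(a, b) = (tail G e, head G e) \<or> (a, b) = (head G e, tail G e)"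
    by (auto simp: parcs_mk_symmetric)
  have "(a, b) \<noteq> (head G e, tail G e)"
    using assms(1)[OF e(1)] assms(2,3) by (auto simp: oriented_away_def)
  then show ?thesis using e by auto
qed

lemma apath_suffix:
  assumes "pre_digraph.apath (mk_symmetric G) u w x" "v \<in> set (pawalk_verts u w)"
  obtains w' where "pre_digraph.awalk (mk_symmetric G) v w' x" "distinct (v # map snd w')"
    "set w' \<subseteq> set w" "set (map snd w') \<subseteq> set (pawalk_verts u w)"
proof -
  interpret D: pair_wf_digraph "mk_symmetric G" by (rule wellformed_mk_symmetric)
  have w: "D.awalk u w x" "distinct (pawalk_verts u w)" using assms(1) by (auto simp: D.apath_def)
  obtain q w' where q: "w = q @ w'" "D.awalk u q v" "D.awalk v w' x"
    using D.awalk_decomp[OF w(1) assms(2)] by blast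
  have "D.apath v w' x" using assms(1) q by (simp add: D.apath_append_iff)
  then have "distinct (pawalk_verts v w')" by (simp add: D.apath_def)
  moreover have "pawalk_verts v w' = v # map snd w'"
    using q(3) D.awalk_verts_conv'[of v w' x] by (cases w') (auto simp: D.awalk_def)
  moreover have "set (map snd w') \<subseteq> set (pawalk_verts u w)"
    using D.set_awalk_verts[OF w(1)] q(1) by auto
  ultimately show thesis using that[OF q(3)] q(1) by auto
qed

text \<open>Otherwise the part of the path from head to tail is empty (a loop), a single edge
  (\<open>e\<close> traversed backwards), or closes up with \<open>e\<close> to a cycle of length at
  least three.\<close>

lemma head_not_on_path_to_tail:
  assumes tree: "underlying_tree G" and away: "\<And>e. e \<in> arcs G \<Longrightarrow> oriented_away G r e"
    and e: "e \<in> arcs G" and w: "pre_digraph.apath (mk_symmetric G) r w (tail G e)"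
  shows "head G e \<notin> set (pawalk_verts r w)"
proof
  interpret D: pair_wf_digraph "mk_symmetric G" by (rule wellformed_mk_symmetric)
  let ?x = "tail G e" and ?v = "head G e"
  assume "?v \<in> set (pawalk_verts r w)"
  from apath_suffix[OF w this] obtain w' where w': "D.awalk ?v w' ?x" "distinct (?v # map snd w')" "set w' \<subseteq> set w"
    by metis
  have xv: "?x \<noteq> ?v" using tree e by (auto simp: underlying_tree_def underlying_forest_def)
  have arc: "(?x, ?v) \<in> parcs (mk_symmetric G)" using e by (auto simp: parcs_mk_symmetric)
  show False
  proof (cases w')
    case Nil
    then show False using w'(1) xv by (auto simp: D.awalk_Nil_iff)
  next
    case (Cons f w'')
    show False
    proof (cases w'')
      case Nil
      then have "f = (?v, ?x)" using w'(1) Cons by (cases f) (auto simp: D.awalk_simps)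
      then have "(?v, ?x) \<in> set w" using w'(3) Cons by auto
      then show False using away[OF e] w by (auto simp: oriented_away_def)
    next
      case (Cons f' w''')
      have "D.awalk ?v (w' @ [(?x, ?v)]) ?v"
        using w'(1) arc by (intro D.awalk_appendI[OF w'(1)]) (auto simp: D.awalk_simps dest: D.in_arcsD2)
      moreover have "distinct (map snd (w' @ [(?x, ?v)]))" using w'(2) by simp
      moreover have "length (w' @ [(?x, ?v)]) \<ge> 3" using Cons \<open>w' = f # w''\<close> by simp
      ultimately show False by (rule no_long_cycle[OF tree])
    qed
  qed
qed

text \<open>Extend a path from \<open>r\<close> to the tail of \<open>f\<close> by \<open>f\<close>
  and then by \<open>e\<close> backwards. If the tail of \<open>e\<close> is already on the path, a
  cycle arises; otherwise the extended path violates the orientation of \<open>e\<close>.\<close>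

lemma arborescence_tail_unique:
  assumes tree: "underlying_tree G" and away: "\<And>e. e \<in> arcs G \<Longrightarrow> oriented_away G r e"
    and r: "r \<in> verts G" and e: "e \<in> arcs G" and f: "f \<in> arcs G" and head: "head G e = head G f"
  shows "tail G e = tail G f"
proof (rule ccontr)
  interpret D: pair_wf_digraph "mk_symmetric G" by (rule wellformed_mk_symmetric)
  let ?x = "tail G e" and ?y = "tail G f" and ?v = "head G f"
  assume xy: "?x \<noteq> ?y"
  have arcs: "(?y, ?v) \<in> parcs (mk_symmetric G)" "(?v, ?x) \<in> parcs (mk_symmetric G)"
    using f e by (auto simp: parcs_mk_symmetric head[symmetric])
  have xv: "?x \<noteq> ?v" "?y \<noteq> ?v" using tree e f head by (auto simp: underlying_tree_def underlying_forest_def)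
  obtain w where w: "D.apath r w ?y" using underlying_path_exists[OF tree r tail_in_verts[OF f]] .
  have v: "?v \<notin> set (pawalk_verts r w)" by (rule head_not_on_path_to_tail[OF tree away f w])
  have ext: "D.awalk ?y [(?y, ?v), (?v, ?x)] ?x"
    using arcs by (auto simp: D.awalk_simps dest: D.in_arcsD2)
  show False
  proof (cases "?x \<in> set (pawalk_verts r w)")
    case True
    from apath_suffix[OF w this] obtain w' where w': "D.awalk ?x w' ?y" "distinct (?x # map snd w')"
      "set (map snd w') \<subseteq> set (pawalk_verts r w)" by metis
    have "w' \<noteq> []" using w'(1) xy by (auto simp: D.awalk_Nil_iff)
    then have "length (w' @ [(?y, ?v), (?v, ?x)]) \<ge> 3" by (cases w') auto
    moreover have "distinct (map snd (w' @ [(?y, ?v), (?v, ?x)]))"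
      using w'(2,3) v xv by auto
    ultimately show False
      using no_long_cycle[OF tree D.awalk_appendI[OF w'(1) ext]] by blast
  next
    case False
    have rw: "D.awalk r w ?y" "distinct (pawalk_verts r w)" using w by (auto simp: D.apath_def)
    then have last: "last (pawalk_verts r w) = ?y" by simp
    have "D.apath r (w @ [(?y, ?v), (?v, ?x)]) ?x"
      unfolding D.apath_append_iff last using w ext v xv False xy arcs
      by (auto simp: D.apath_def)
    then show False using away[OF e] head by (auto simp: oriented_away_def)
  qed
qed

lemma awalk_enters:
  assumes "pre_digraph.awalk (mk_symmetric G) u w x" "u \<notin> S" "x \<in> S"
  shows "\<exists>(a, b)\<in>set w. a \<notin> S \<and> b \<in> S"
proof -
  interpret D: pair_wf_digraph "mk_symmetric G" by (rule wellformed_mk_symmetric)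
  show ?thesis using assms
  proof (induction w arbitrary: u)
    case Nil
    then show ?case by (auto simp: D.awalk_simps)
  next
    case (Cons f w)
    then show ?case by (cases "snd f \<in> S") (auto simp: D.awalk_simps)
  qed
qed

end

section \<open>The deepest vertex of an undirected cycle\<close>

lemma pcas_consecutive: "pcas u c v \<Longrightarrow> Suc i < length c \<Longrightarrow> fst (c ! Suc i) = snd (c ! i)"
proof (induction u c v arbitrary: i rule: pcas.induct)
  case (2 u e es v)
  then show ?case by (cases i; cases es) auto
qed simp

lemma pcas_ends: "pcas u c v \<Longrightarrow> c \<noteq> [] \<Longrightarrow> fst (hd c) = u \<and> snd (last c) = v"
proof (induction u c v rule: pcas.induct)
  case (2 u e es v)
  then show ?case by (cases es) auto
qed simp

text \<open>With \<open>d\<close> a depth function, this refutes cycles: neither neighbour of the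
  deepest vertex is a child of it, so both would be its only parent.\<close>

lemma cycle_peak:
  fixes d :: "'a \<Rightarrow> nat"
  assumes c: "pcas u c u" "length c \<ge> 3" "distinct (map snd c)"
  obtains x y z where "(y, x) \<in> set c" "(x, z) \<in> set c" "y \<noteq> z" "d y \<le> d x" "d z \<le> d x"
proof -
  let ?n = "length c"
  have "c \<noteq> []" using c by auto
  have "finite (d ` set (map snd c))" "d ` set (map snd c) \<noteq> {}" using \<open>c \<noteq> []\<close> by auto
  then have "Max (d ` set (map snd c)) \<in> d ` set (map snd c)" by (rule Max_in)
  then obtain i where i: "i < ?n" "d (snd (c ! i)) = Max (d ` set (map snd c))"
    by (auto simp: in_set_conv_nth)
  have max: "d (snd (c ! j)) \<le> d (snd (c ! i))" if "j < ?n" for j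
    unfolding i(2) using that by (intro Max_ge) auto
  \<comment> \<open>\<open>j\<close> and \<open>k\<close> are the cyclic successor and predecessor
    of \<open>i\<close>; they differ because the length is at least three.\<close>
  define j where "j = (if Suc i = ?n then 0 else Suc i)"
  define k where "k = (if i = 0 then ?n - 1 else i - 1)"
  have j: "j < ?n" and k: "k < ?n" and jk: "k \<noteq> j" using i c(2) by (auto simp: j_def k_def)
  have wrap: "fst (c ! 0) = snd (c ! (?n - 1))"
    using pcas_ends[OF c(1) \<open>c \<noteq> []\<close>] \<open>c \<noteq> []\<close> by (simp add: hd_conv_nth last_conv_nth)
  have 1: "fst (c ! j) = snd (c ! i)"
  proof (cases "Suc i = ?n")
    case True
    then have "i = ?n - 1" by simp
    then show ?thesis using wrap True by (simp add: j_def)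
  next
    case False
    then show ?thesis using pcas_consecutive[OF c(1), of i] i(1) by (simp add: j_def)
  qed
  have 2: "fst (c ! i) = snd (c ! k)"
  proof (cases "i = 0")
    case False
    then show ?thesis using pcas_consecutive[OF c(1), of "i - 1"] i(1) by (simp add: k_def)
  qed (use wrap in \<open>simp add: k_def\<close>)
  show thesis
  proof (rule that)
    show "(snd (c ! k), snd (c ! i)) \<in> set c" using 2 i(1) by (metis nth_mem prod.collapse)
    show "(snd (c ! i), snd (c ! j)) \<in> set c" using 1 j by (metis nth_mem prod.collapse)
    show "snd (c ! k) \<noteq> snd (c ! j)" using c(3) j k jk by (auto simp: distinct_conv_nth)
  qed (use max j k in auto)
qed

section \<open>Correspondence of arborescences and parent maps\<close>

context tournament
begin

lemma arc_unique:
  assumes "e \<in> arcs G" "f \<in> arcs G" "{tail G e, head G e} = {tail G f, head G f}"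
  shows "e = f"
proof -
  have "\<exists>!f. f \<in> arcs G \<and> {tail G f, head G f} = {tail G e, head G e}"
    using assms(1) by (intro ex1_arc) (auto dest: no_loops)
  then show ?thesis using assms by metis
qed

lemma ptree_of_arborescence:
  assumes T: "arborescence G r T"
  obtains p where "p \<in> ptree (arcs_ends G) (verts G - {r})" "parent_graph G r p = T"
proof -
  have sub: "verts T = verts G" "arcs T \<subseteq> arcs G" "tail T = tail G" "head T = head G" "wf_digraph T"
    using T by (auto simp: arborescence_def spanning_def subgraph_def compatible_def)
  have tree: "underlying_tree T" and rT: "r \<in> verts T" and away: "\<And>e. e \<in> arcs T \<Longrightarrow> oriented_away T r e"
    using T by (auto simp: arborescence_def)
  interpret T: wf_digraph T by (rule sub(5))
  interpret D: pair_wf_digraph "mk_symmetric T" by (rule T.wellformed_mk_symmetric)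
  have parent: "\<exists>e\<in>arcs T. head T e = v" if v: "v \<in> verts T" "v \<noteq> r" for v
  proof -
    obtain w where w: "D.apath r w v" using T.underlying_path_exists[OF tree rT v(1)] .
    then obtain a b where "(a, b) \<in> set w" "a \<notin> {v}" "b \<in> {v}"
      using T.awalk_enters[of r w v "{v}"] v(2) by (auto simp: D.apath_def)
    then show ?thesis using T.path_from_root_arc[OF away w] by auto
  qed
  have root: "head T e \<noteq> r" if e: "e \<in> arcs T" for e
  proof
    assume *: "head T e = r"
    obtain w where w: "D.apath r w (tail T e)"
      using T.underlying_path_exists[OF tree rT T.tail_in_verts[OF e]] .
    then show False using T.head_not_on_path_to_tail[OF tree away e w] * D.hd_in_awalk_verts(2)[OF w] by simp
  qed
  \<comment> \<open>The choice is unambiguous on tails by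
    \<open>arborescence_tail_unique\<close>.\<close>
  define p where "p v = (if v \<in> verts G - {r} then tail T (SOME e. e \<in> arcs T \<and> head T e = v) else undefined)" for v
  have p: "p (head T e) = tail T e" if e: "e \<in> arcs T" for e
  proof -
    define f where "f = (SOME f. f \<in> arcs T \<and> head T f = head T e)"
    have "f \<in> arcs T \<and> head T f = head T e" unfolding f_def by (rule someI[of _ e]) (use e in simp)
    moreover have "p (head T e) = tail T f"
      using root[OF e] T.head_in_verts[OF e] sub(1) by (simp add: p_def f_def)
    ultimately show ?thesis using T.arborescence_tail_unique[OF tree away rT _ e] by metis
  qed
  have "p \<in> ptree (arcs_ends G) (verts G - {r})"
  proof (rule ptreeI)
    fix x assume "x \<in> verts G - {r}"
    then obtain e where e: "e \<in> arcs T" "head T e = x" using parent[of x] sub(1) by auto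
    then show "(p x, x) \<in> arcs_ends G"
      using p[OF e(1)] sub by (auto simp: arcs_ends_conv intro!: image_eqI[of _ _ e])
  next
    \<comment> \<open>A path from \<open>r\<close> must enter \<open>S\<close> through an arc of
      \<open>T\<close>, whose tail outside \<open>S\<close> is the parent of its head.\<close>
    fix S assume S: "S \<subseteq> verts G - {r}" "S \<noteq> {}" "\<And>x. x \<in> S \<Longrightarrow> p x \<in> S"
    then obtain x where x: "x \<in> S" by blast
    then obtain w where w: "D.apath r w x" using T.underlying_path_exists[OF tree rT, of x] S(1) sub(1) by blast
    then obtain a b where ab: "(a, b) \<in> set w" "a \<notin> S" "b \<in> S"
      using T.awalk_enters[of r w x S] x S(1) by (auto simp: D.apath_def)
    then obtain e where "e \<in> arcs T" "tail T e = a" "head T e = b"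
      using T.path_from_root_arc[OF away w] by blast
    then show False using p[of e] S(3)[OF ab(3)] ab(2) by simp
  qed (auto simp: p_def)
  moreover have "parent_graph G r p = T"
  proof (rule pre_digraph.equality)
    show "arcs (parent_graph G r p) = arcs T"
    proof (intro equalityI subsetI)
      fix e assume "e \<in> arcs T"
      then show "e \<in> arcs (parent_graph G r p)" using p[of e] root[of e] sub by auto
    next
      fix e assume e: "e \<in> arcs (parent_graph G r p)"
      then obtain f where f: "f \<in> arcs T" "head T f = head G e"
        using parent[of "head G e"] sub(1) by auto
      then have "e = f" using e p[OF f(1)] sub by (intro arc_unique) auto
      then show "e \<in> arcs T" using f by simp
    qed
  qed (use sub in simp_all)
  ultimately show thesis by (rule that)
qed

lemma arborescence_of_ptree:
  assumes r: "r \<in> verts G" and p: "p \<in> ptree (arcs_ends G) (verts G - {r})"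
  shows "arborescence G r (parent_graph G r p)"
proof -
  let ?U = "verts G - {r}" and ?H = "parent_graph G r p"
  interpret H: wf_digraph ?H
  proof
    fix e assume "e \<in> arcs ?H"
    then have "e \<in> arcs G" by simp
    then show "tail ?H e \<in> verts ?H" "head ?H e \<in> verts ?H" by simp_all
  qed
  interpret D: pair_wf_digraph "mk_symmetric ?H" by (rule H.wellformed_mk_symmetric)
  obtain d :: "'a \<Rightarrow> nat" where d: "d (p x) < d x" if "x \<in> ?U" for x
    using ptree_depth[OF p] by auto
  have p_arc: "\<exists>e\<in>arcs G. tail G e = p x \<and> head G e = x" if "x \<in> ?U" for x
    using ptree_arc[OF p that] by (auto simp: arcs_ends_conv)
  have parcs: "parcs (mk_symmetric ?H) = (\<lambda>x. (p x, x)) ` ?U \<union> (\<lambda>x. (x, p x)) ` ?U"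
    using p_arc by (auto simp: parcs_mk_symmetric image_iff)
  have p_vert: "p x \<in> verts G" if "x \<in> ?U" for x using p_arc[OF that] tail_in_verts by metis
  have reach: "r \<rightarrow>\<^sup>*\<^bsub>mk_symmetric ?H\<^esub> x" if "x \<in> verts G" for x
  proof (rule ccontr)
    assume "\<not> r \<rightarrow>\<^sup>*\<^bsub>mk_symmetric ?H\<^esub> x"
    \<comment> \<open>The unreachable vertices would form a nonempty set closed under
      \<open>p\<close>.\<close>
    let ?S = "{x \<in> verts G. \<not> r \<rightarrow>\<^sup>*\<^bsub>mk_symmetric ?H\<^esub> x}"
    have "r \<rightarrow>\<^sup>*\<^bsub>mk_symmetric ?H\<^esub> r" using r by (intro D.reachable_refl) simp
    then have S: "?S \<subseteq> ?U" "?S \<noteq> {}" using that \<open>\<not> _\<close> by auto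
    obtain y where y: "y \<in> ?S" "p y \<notin> ?S" using ptree_exit[OF p S] .
    then have "r \<rightarrow>\<^sup>*\<^bsub>mk_symmetric ?H\<^esub> p y" using p_vert S by auto
    moreover have "(p y, y) \<in> parcs (mk_symmetric ?H)" using y S unfolding parcs by auto
    ultimately have "r \<rightarrow>\<^sup>*\<^bsub>mk_symmetric ?H\<^esub> y" using D.reachable_adj_trans[of r "p y" y] by simp
    then show False using y by simp
  qed
  have conn: "connected ?H"
    unfolding connected_def strongly_connected_def
  proof (intro conjI ballI)
    fix u v assume "u \<in> verts (mk_symmetric ?H)" "v \<in> verts (mk_symmetric ?H)"
    then show "u \<rightarrow>\<^sup>*\<^bsub>mk_symmetric ?H\<^esub> v"
      using D.reachable_trans[OF symmetric_reachable[OF symmetric_mk_symmetric reach[of u]] reach[of v]] by simp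
  qed (use r in auto)
  have no_cycle: False if c: "D.cycle c" "length c \<ge> 3" for c
  proof -
    obtain u where u: "D.awalk u c u" "distinct (tl (pawalk_verts u c))"
      using c(1) unfolding D.cycle_def by auto
    then have cas: "pcas u c u" "set c \<subseteq> parcs (mk_symmetric ?H)" by (auto simp: D.awalk_def)
    have "c \<noteq> []" using c(2) by auto
    then have "distinct (map snd c)" using u(2) D.awalk_verts_conv'[OF cas(1)] by simp
    then obtain x y z where xyz: "(y, x) \<in> set c" "(x, z) \<in> set c" "y \<noteq> z" "d y \<le> d x" "d z \<le> d x"
      using cycle_peak[OF cas(1) c(2)] by blast
    have "y = p x"
    proof (rule ccontr)
      assume "y \<noteq> p x"
      then have "y \<in> ?U" "x = p y" using xyz(1) cas(2) unfolding parcs by auto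
      then show False using d[of y] xyz(4) by simp
    qed
    moreover have "z = p x"
    proof (rule ccontr)
      assume "z \<noteq> p x"
      then have "z \<in> ?U" "x = p z" using xyz(2) cas(2) unfolding parcs by auto
      then show False using d[of z] xyz(5) by simp
    qed
    ultimately show False using xyz(3) by simp
  qed
  have "underlying_forest ?H"
    unfolding underlying_forest_def using no_cycle
    by (auto intro!: inj_onI arc_unique dest: no_loops)
  moreover have "oriented_away ?H r e" if e: "e \<in> arcs ?H" for e
    unfolding oriented_away_def
  proof (intro allI impI notI)
    fix w v assume w: "D.apath r w v" "(head ?H e, tail ?H e) \<in> set w"
    \<comment> \<open>A path from \<open>r\<close> can only descend: the parent of the current
      vertex has been visited already, so each step leads to a child.\<close>
    have down: "b \<in> ?U \<and> a = p b"
      if "D.apath u w v" "u = r \<or> p u \<notin> set (pawalk_verts u w)" "(a, b) \<in> set w" for u w a b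
      using that
    proof (induction w arbitrary: u)
      case (Cons f w)
      obtain y where f: "f = (u, y)" using Cons.prems(1) by (cases f) (auto simp: D.apath_Cons_iff)
      have ap: "D.apath y w v" "u \<notin> set (pawalk_verts y w)" "(u, y) \<in> parcs (mk_symmetric ?H)"
        using Cons.prems(1) f by (auto simp: D.apath_Cons_iff)
      have "y \<in> set (pawalk_verts y w)" using D.hd_in_awalk_verts(2)[OF ap(1)] .
      then have "y \<in> ?U \<and> u = p y" using ap(3) Cons.prems(2) f unfolding parcs by auto
      then show ?case using Cons.IH[OF ap(1)] Cons.prems(3) ap(2) f by auto
    qed simp
    have "tail G e \<in> ?U \<and> head G e = p (tail G e)" using down[OF w(1)] w(2) by simp
    moreover have "head G e \<in> ?U \<and> tail G e = p (head G e)" using e by auto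
    ultimately show False using d[of "tail G e"] d[of "head G e"] by auto
  qed
  moreover have "spanning ?H G"
    unfolding spanning_def subgraph_def compatible_def
    using H.wf_digraph_axioms wf_digraph_axioms by auto
  ultimately show ?thesis using conn r by (auto simp: arborescence_def underlying_tree_def)
qed

lemma inj_on_parent_graph: "inj_on (parent_graph G r) (ptree (arcs_ends G) (verts G - {r}))"
proof (rule inj_onI)
  fix p q assume pq: "p \<in> ptree (arcs_ends G) (verts G - {r})" "q \<in> ptree (arcs_ends G) (verts G - {r})"
    "parent_graph G r p = parent_graph G r q"
  show "p = q"
  proof
    fix x
    show "p x = q x"
    proof (cases "x \<in> verts G - {r}")
      case True
      then obtain e where "e \<in> arcs G" "tail G e = p x" "head G e = x"
        using ptree_arc[OF pq(1) True] by (auto simp: arcs_ends_conv)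
      then have "e \<in> arcs (parent_graph G r q)" using True by (subst pq(3)[symmetric]) simp
      then show ?thesis using \<open>tail G e = p x\<close> \<open>head G e = x\<close> by simp
    next
      case False
      then show ?thesis using ptree_outside pq by metis
    qed
  qed
qed

lemma arc_flip_parent_graph:
  assumes p: "p \<in> ptree (arcs_ends G) (verts G - {r})" and q: "q \<in> ptree (arcs_ends G) (verts G - {r})"
    and "parent_flip p q"
  shows "arc_flip (parent_graph G r p) (parent_graph G r q)"
proof -
  obtain x y where "q = p(x := y)" "p \<noteq> q" using assms(3) by (auto simp: parent_flip_def)
  then have xy: "q = p(x := y)" "p x \<noteq> y" by auto
  have x: "x \<in> verts G - {r}"
    using ptree_outside[OF p] ptree_outside[OF q] xy by (metis fun_upd_same)
  obtain e where e: "e \<in> arcs G" "tail G e = p x" "head G e = x"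
    using ptree_arc[OF p x] by (auto simp: arcs_ends_conv)
  obtain f where f: "f \<in> arcs G" "tail G f = y" "head G f = x"
    using ptree_arc[OF q x] xy by (auto simp: arcs_ends_conv)
  have "arcs (parent_graph G r q) = insert f (arcs (parent_graph G r p) - {e})"
    using x xy e f by (auto intro: arc_unique)
  moreover have "e \<in> arcs (parent_graph G r p)" "f \<notin> arcs (parent_graph G r p)"
    using x xy e f by auto
  ultimately show ?thesis unfolding arc_flip_def by blast
qed

end

text \<open>Membership in \<open>V\<close> is recorded for both ends of each step because the arcs
  of \<open>flip_graph\<close> demand two arborescences.\<close>

lemma ham_path_list:
  assumes "ham_path R V x y"
  shows "\<exists>xs. xs \<noteq> [] \<and> hd xs = x \<and> distinct xs \<and> set xs = V \<and> (\<forall>(a, b)\<in>set (vwalk_arcs xs). a \<in> V \<and> b \<in> V \<and> R a b)"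
  using assms
proof (induction rule: ham_path.induct)
  case (single x)
  show ?case by (intro exI[of _ "[x]"]) auto
next
  case (step V y z x)
  then obtain xs where xs: "xs \<noteq> []" "hd xs = y" "distinct xs" "set xs = V"
    "\<forall>(a, b)\<in>set (vwalk_arcs xs). a \<in> V \<and> b \<in> V \<and> R a b" by blast
  then obtain ys where "xs = y # ys" by (cases xs) auto
  then show ?case using xs step.hyps by (intro exI[of _ "x # xs"]) auto
qed

theorem theorem1:
  fixes G :: "('a, 'b) pre_digraph" and r :: 'a
  assumes "tournament G" and "r \<in> verts G"
  shows "pverts (flip_graph G r) = {} \<or>
         (\<exists>p. hamiltonian_path (with_proj (flip_graph G r)) p)"
proof -
  interpret tournament G by (rule assms(1))
  let ?P = "ptree (arcs_ends G) (verts G - {r})"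
  have arbs: "{T. arborescence G r T} = parent_graph G r ` ?P"
    using arborescence_of_ptree[OF assms(2)] ptree_of_arborescence by blast
  have "flips_traceable (arcs_ends G) (verts G - {r})"
  proof (rule flips_traceable_ptree)
    fix x y assume "x \<in> verts G - {r}" "y \<in> verts G - {r}" "x \<noteq> y"
    then obtain e where "e \<in> arcs G" "{tail G e, head G e} = {x, y}" using ex1_arc[of x y] by blast
    then show "(x, y) \<in> arcs_ends G \<or> (y, x) \<in> arcs_ends G"
      by (auto simp: arcs_ends_conv doubleton_eq_iff image_iff)
  qed (auto simp: arcs_ends_def)
  show ?thesis
  proof (cases "?P = {}")
    case True
    then show ?thesis using arbs by (simp add: flip_graph_def)
  next
    case False
    then obtain s t where "ham_path parent_flip ?P s t" using flips_traceableD[OF \<open>flips_traceable _ _\<close>] by blast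
    then have "ham_path arc_flip {T. arborescence G r T} (parent_graph G r s) (parent_graph G r t)"
      unfolding arbs by (rule ham_path_image) (auto intro: inj_on_parent_graph arc_flip_parent_graph)
    from ham_path_list[OF this] obtain xs where "xs \<noteq> []" "distinct xs" "set xs = {T. arborescence G r T}"
      "\<forall>(S, T)\<in>set (vwalk_arcs xs). arborescence G r S \<and> arborescence G r T \<and> arc_flip S T" by auto
    then have "hamiltonian_path (with_proj (flip_graph G r)) xs"
      by (auto simp: hamiltonian_path_def vpath_def vwalk_def flip_graph_def)
    then show ?thesis by blast
  qed
qed


end
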